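(* For every $N\ge 2$, $p\ge 1$ and every pair of enumerated point clouds $\mathcal{Y}=\{y_i\}_{i=1}^N$ and $\mathcal{Y}'=\{y'_i\}_{i=1}^N$ in $\mathbb{R}^p$, let $F(\mathcal{Y})$ and $F(\mathcal{Y}')$ denote their kNN-ordering matrices, let $D_{\mathcal{Y}}$ and $D_{\mathcal{Y}'}$ denote the persistence diagrams of the kNN filtrations applied to $\mathcal{Y}$ and $\mathcal{Y}'$, and put $$\|F(\mathcal{Y})-F(\mathcal{Y}')\|_\infty=\max_{i,j}|F_{ij}(\mathcal{Y})-F_{ij}(\mathcal{Y}')|,\qquad \|\mathcal{Y}-\mathcal{Y}'\|_\infty=\max_{i}\|y_i-y'_i\|_2 .$$ Then $d_B(D_{\mathcal{Y}},D_{\mathcal{Y}'})\le \|F(\mathcal{Y})-F(\mathcal{Y}')\|_\infty$ for all such pairs, but this does not extend to a uniform global bound in terms of the point locations: there is no constant $L$ such that $$d_B(D_{\mathcal{Y}},D_{\mathcal{Y}'})\le \|F(\mathcal{Y})-F(\mathcal{Y}')\|_\infty\le L\,\|\mathcal{Y}-\mathcal{Y}'\|_\infty$$ holds for all such pairs $\mathcal{Y},\mathcal{Y}'$.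
   Context: Let $\mathcal{V}=\{1,\dots,N\}$. For an enumerated point cloud $\mathcal{Y}=\{y_i\}_{i\in\mathcal{V}}\subset\mathbb{R}^p$ let $f_{ij}(\mathcal{Y})=\|y_i-y_j\|_2$. Standing assumption: all point clouds considered have well-defined orderings, i.e. for each fixed $i$ the numbers $f_{i1},\dots,f_{iN}$ are pairwise distinct (in particular the points are distinct). kNN-ordering matrix: $F(\mathcal{Y})=[k_{ij}]_{i,j\in\mathcal{V}}$, where $k_{ii}=0$ and, for $j\ne i$, $y_j$ is the $k_{ij}$-th nearest neighbor of $y_i$; equivalently $k_{ij}=\#\{l\in\mathcal{V}: f_{il}<f_{ij}\}$ (each row is obtained by applying "argsort" to the corresponding row of $[f_{ij}]$). kNN filtration: fix one of the three symmetrizations $s_{ij}=\min\{k_{ij},k_{ji}\}$, $s_{ij}=(k_{ij}+k_{ji})/2$, or $s_{ij}=\max\{k_{ij},k_{ji}\}$ (the same one for all clouds). For each filtration parameter $k$ with $0\le k\le N-1$ (integers; also half-integers for the averaged symmetrization), let $\mathcal{G}_k$ be the undirected graph on $\mathcal{V}$ with an edge between distinct $i,j$ iff $s_{ij}\le k$, and let $X_k=Cl(\mathcal{G}_k)$ be its clique complex (simplices are the nonempty vertex sets that are pairwise adjacent). The kNN filtration is $\{X_k\hookrightarrow X_{k'}\}_{0\le k\le k'\le N-1}$. The persistence diagram is that of simplicial homology, in a fixed degree and with coefficients in a fixed field, along this filtration: the multiset of (birth, death) pairs (death possibly $\infty$), together with all diagonal points with infinite multiplicity. The bottleneck distance of two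 diagrams is $d_B(D,D')=\inf_\gamma\sup_{y\in D}\|y-\gamma(y)\|_\infty$, where $\gamma$ ranges over all bijections of multisets $D\to D'$. *)

theory Defs
  imports
    "HOL-Analysis.L2_Norm"
    "HOL-Library.Extended_Real"
    "HOL-Library.Function_Algebras"
    "HOL-Library.Set_Algebras"
    "Jordan_Normal_Form.VS_Connect"
begin

section \<open>Point clouds and kNN-ordering matrices\<close>

text \<open>
  A point of \<open>\<real>\<^sup>p\<close> is a function of type \<open>nat \<Rightarrow> real\<close> of which only the coordinates in \<open>{..<p}\<close>
  are ever inspected; a cloud \<open>Y\<close> enumerates its points by \<open>{1..N}\<close>. The dimension is a number
  and not a type because the non-existence of a uniform constant quantifies over it.
\<close>

type_synonym cloud = "nat \<Rightarrow> nat \<Rightarrow> real"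

definition euclid_dist :: "nat \<Rightarrow> (nat \<Rightarrow> real) \<Rightarrow> (nat \<Rightarrow> real) \<Rightarrow> real" where
  "euclid_dist p x y = L2_set (\<lambda>c. x c - y c) {..<p}"

definition well_ordered_cloud :: "nat \<Rightarrow> nat \<Rightarrow> cloud \<Rightarrow> bool" where
  "well_ordered_cloud N p Y \<longleftrightarrow> (\<forall>i\<in>{1..N}. inj_on (\<lambda>j. euclid_dist p (Y i) (Y j)) {1..N})"

definition knn_order :: "nat \<Rightarrow> nat \<Rightarrow> cloud \<Rightarrow> nat \<Rightarrow> nat \<Rightarrow> nat" where
  "knn_order N p Y i j =
     card {l \<in> {1..N}. euclid_dist p (Y i) (Y l) < euclid_dist p (Y i) (Y j)}"

definition knn_matrix_dist :: "nat \<Rightarrow> nat \<Rightarrow> cloud \<Rightarrow> cloud \<Rightarrow> real" where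
  "knn_matrix_dist N p Y Y' =
     Max ((\<lambda>(i, j). \<bar>real (knn_order N p Y i j) - real (knn_order N p Y' i j)\<bar>) ` ({1..N} \<times> {1..N}))"

definition cloud_dist :: "nat \<Rightarrow> nat \<Rightarrow> cloud \<Rightarrow> cloud \<Rightarrow> real" where
  "cloud_dist N p Y Y' = Max ((\<lambda>i. euclid_dist p (Y i) (Y' i)) ` {1..N})"


section \<open>The kNN filtration\<close>

datatype symmetrization = SymMin | SymAvg | SymMax

fun symmetrize :: "symmetrization \<Rightarrow> nat \<Rightarrow> nat \<Rightarrow> real" where
  "symmetrize SymMin a b = real (min a b)"
| "symmetrize SymAvg a b = (real a + real b) / 2"
| "symmetrize SymMax a b = real (max a b)"

definition clique_complex :: "'a set \<Rightarrow> ('a \<Rightarrow> 'a \<Rightarrow> bool) \<Rightarrow> 'a set set" where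
  "clique_complex V adj = {\<sigma>. \<sigma> \<noteq> {} \<and> \<sigma> \<subseteq> V \<and> (\<forall>i\<in>\<sigma>. \<forall>j\<in>\<sigma>. i \<noteq> j \<longrightarrow> adj i j)}"

definition knn_graph_adj ::
  "symmetrization \<Rightarrow> nat \<Rightarrow> nat \<Rightarrow> cloud \<Rightarrow> real \<Rightarrow> nat \<Rightarrow> nat \<Rightarrow> bool" where
  "knn_graph_adj s N p Y k i j \<longleftrightarrow>
     i \<noteq> j \<and> symmetrize s (knn_order N p Y i j) (knn_order N p Y j i) \<le> k"

definition knn_complex :: "symmetrization \<Rightarrow> nat \<Rightarrow> nat \<Rightarrow> cloud \<Rightarrow> real \<Rightarrow> nat set set" where
  "knn_complex s N p Y k = clique_complex {1..N} (knn_graph_adj s N p Y k)"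

text \<open>
  The filtration parameters in \<open>[0, N - 1]\<close> are enumerated increasingly as
  \<open>param s 0, \<dots>, param s (last_index s N)\<close>: integers for the minimum and the maximum,
  integers and half-integers for the average.
\<close>

fun param :: "symmetrization \<Rightarrow> nat \<Rightarrow> real" where
  "param SymAvg j = real j / 2"
| "param SymMin j = real j"
| "param SymMax j = real j"

fun last_index :: "symmetrization \<Rightarrow> nat \<Rightarrow> nat" where
  "last_index SymAvg N = 2 * (N - 1)"
| "last_index SymMin N = N - 1"
| "last_index SymMax N = N - 1"


section \<open>Simplicial homology with field coefficients\<close>

text \<open>
  A complex is a finite set of finite nonempty sets of vertices. A simplex is oriented by the
  order of its vertices; a chain is its coefficient function, zero off the simplices of the given
  dimension. The empty set is not a simplex, so homology is not reduced.
\<close>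

definition chains :: "nat set set \<Rightarrow> nat \<Rightarrow> (nat set \<Rightarrow> 'f::field) set" where
  "chains X n = {c. \<forall>\<sigma>. \<not> (\<sigma> \<in> X \<and> card \<sigma> = Suc n) \<longrightarrow> c \<sigma> = 0}"

definition boundary :: "nat set set \<Rightarrow> (nat set \<Rightarrow> 'f::field) \<Rightarrow> nat set \<Rightarrow> 'f" where
  "boundary X c \<tau> =
     (if \<tau> = {} then 0
      else (\<Sum>\<sigma>\<in>X. \<Sum>v\<in>\<sigma>. if \<sigma> - {v} = \<tau> then (-1) ^ card {u\<in>\<sigma>. u < v} * c \<sigma> else 0))"

definition cycles :: "nat set set \<Rightarrow> nat \<Rightarrow> (nat set \<Rightarrow> 'f::field) set" where
  "cycles X n = {c \<in> chains X n. boundary X c = 0}"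

definition boundaries :: "nat set set \<Rightarrow> nat \<Rightarrow> (nat set \<Rightarrow> 'f::field) set" where
  "boundaries X n = boundary X ` chains X (Suc n)"

text \<open>
  The quotient \<open>W / U\<close> of spaces of functions, with cosets as elements. Adding \<open>U\<close> in the scalar
  multiplication only matters for the scalar \<open>0\<close>. The fields \<open>mult\<close> and \<open>one\<close> exist because
  module records extend ring records and play no role.
\<close>

definition quotient_space ::
  "('a \<Rightarrow> 'f::field) set \<Rightarrow> ('a \<Rightarrow> 'f) set \<Rightarrow> ('f, ('a \<Rightarrow> 'f) set) module" where
  "quotient_space W U =
     \<lparr>carrier = (\<lambda>w. w +o U) ` W, mult = undefined, one = undefined, zero = U, add = (+),
      smult = (\<lambda>a A. (\<lambda>w x. a * w x) ` A + U)\<rparr>"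

definition homology :: "nat set set \<Rightarrow> nat \<Rightarrow> ('f::field, (nat set \<Rightarrow> 'f) set) module" where
  "homology X n = quotient_space (cycles X n) (boundaries X n)"

text \<open>
  For a subcomplex \<open>X \<subseteq> X'\<close> the map induced by the inclusion sends the class of a cycle \<open>z\<close> in
  \<open>X\<close> to its class in \<open>X'\<close>; on cosets this is \<open>A \<mapsto> A + B\<close> with \<open>B\<close> the boundaries of \<open>X'\<close>.
\<close>

definition induced_map ::
  "nat set set \<Rightarrow> nat \<Rightarrow> (nat set \<Rightarrow> 'f::field) set \<Rightarrow> (nat set \<Rightarrow> 'f) set" where
  "induced_map X' n A = A + boundaries X' n"

definition homology_rank :: "'f::field itself \<Rightarrow> nat \<Rightarrow> nat set set \<Rightarrow> nat set set \<Rightarrow> nat" where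
  "homology_rank K n X X' =
     vectorspace.dim (class_ring :: 'f ring)
       ((homology X' n)\<lparr>carrier := induced_map X' n ` carrier (homology X n :: ('f, _) module)\<rparr>)"


section \<open>Persistence diagrams\<close>

text \<open>
  Let \<open>X 0 \<subseteq> \<dots> \<subseteq> X m\<close> be a filtration with strictly increasing parameters \<open>t 0, \<dots>, t m\<close>. A class
  of \<open>X i\<close> born at step \<open>i\<close> is one that does not come from \<open>X (i - 1)\<close>; \<open>born_alive K n X i j\<close> is the number
  of independent such classes that survive to step \<open>j \<ge> i\<close>. Both differences of
  persistent Betti numbers below are nonnegative.
\<close>

definition born_alive :: "'f::field itself \<Rightarrow> nat \<Rightarrow> (nat \<Rightarrow> nat set set) \<Rightarrow> nat \<Rightarrow> nat \<Rightarrow> int" where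
  "born_alive K n X i j =
     int (homology_rank K n (X i) (X j)) -
     (if i = 0 then 0 else int (homology_rank K n (X (i - 1)) (X j)))"

definition pair_mult :: "'f::field itself \<Rightarrow> nat \<Rightarrow> (nat \<Rightarrow> nat set set) \<Rightarrow> nat \<Rightarrow> nat \<Rightarrow> nat" where
  "pair_mult K n X i j = nat (born_alive K n X i (j - 1) - born_alive K n X i j)"

text \<open>
  Diagrams are given by their multiplicity functions, as elements of \<^typ>\<open>'a multiset\<close> have
  finite multiplicities and finite support.
\<close>

type_synonym diagram = "real \<times> ereal \<Rightarrow> enat"

definition persistence_diagram ::
  "'f::field itself \<Rightarrow> nat \<Rightarrow> nat \<Rightarrow> (nat \<Rightarrow> real) \<Rightarrow> (nat \<Rightarrow> nat set set) \<Rightarrow> diagram" where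
  "persistence_diagram K n m t X = (\<lambda>(b, d).
     if d = ereal b then \<infinity>
     else if d = \<infinity> then enat (\<Sum>i\<in>{i. i \<le> m \<and> t i = b}. nat (born_alive K n X i m))
     else enat (\<Sum>(i, j)\<in>{(i, j). i < j \<and> j \<le> m \<and> t i = b \<and> ereal (t j) = d}. pair_mult K n X i j))"

definition knn_diagram ::
  "'f::field itself \<Rightarrow> nat \<Rightarrow> symmetrization \<Rightarrow> nat \<Rightarrow> nat \<Rightarrow> cloud \<Rightarrow> diagram" where
  "knn_diagram K n s N p Y =
     persistence_diagram K n (last_index s N) (param s)
       (\<lambda>j. knn_complex s N p Y (param s j))"


section \<open>Bottleneck distance\<close>

text \<open>
  The elements of a multiset, repeated according to their multiplicities. A point of infinite
  multiplicity is repeated once for each natural number.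
\<close>

definition diagram_points :: "diagram \<Rightarrow> ((real \<times> ereal) \<times> nat) set" where
  "diagram_points D = {(x, r). enat r < D x}"

text \<open>
  In \<^typ>\<open>ereal\<close> the value of \<open>\<bar>\<infinity> - \<infinity>\<bar>\<close> is \<open>\<infinity>\<close>, whereas two classes that never die have
  deaths at distance \<open>0\<close>; hence the case distinction.
\<close>

definition death_dist :: "ereal \<Rightarrow> ereal \<Rightarrow> ereal" where
  "death_dist d d' = (if d = d' then 0 else \<bar>d - d'\<bar>)"

fun linf_dist :: "real \<times> ereal \<Rightarrow> real \<times> ereal \<Rightarrow> ereal" where
  "linf_dist (b, d) (b', d') = max (ereal \<bar>b - b'\<bar>) (death_dist d d')"

definition bottleneck_dist :: "diagram \<Rightarrow> diagram \<Rightarrow> ereal" where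
  "bottleneck_dist D D' =
     (INF \<gamma>\<in>{\<gamma>. bij_betw \<gamma> (diagram_points D) (diagram_points D')}.
        SUP y\<in>diagram_points D. linf_dist (fst y) (fst (\<gamma> y)))"

end

theory Submission
  imports Defs "Jordan_Normal_Form.DL_Rank" "HOL-Library.Countable_Set"
begin

text \<open>
  The kNN complexes are the sublevel sets of the function sending a simplex to its largest
  symmetrized edge rank, and these functions differ by at most the distance of the kNN matrices.
  For two functions that order the simplices compatibly, the bars of both filtrations are images of
  the bars of one common refinement, which gives a matching that moves points no further than
  the functions differ. The straight line between two arbitrary functions splits at its finitely many
  order changes into pieces of this kind, whose costs add up. The argument
  uses only monotonicity of the persistent Betti numbers and the exchange inequality that makes
  multiplicities nonnegative.

  Three points on a line, with the first one almost equidistant from the other two, refute the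
  Lipschitz bound: an arbitrarily small move swaps its two neighbours.
\<close>

section \<open>Quotients of function spaces\<close>

definition fun_subspace :: "('a \<Rightarrow> 'f::field) set \<Rightarrow> bool" where
  "fun_subspace U \<longleftrightarrow> 0 \<in> U \<and> (\<forall>u\<in>U. \<forall>v\<in>U. u + v \<in> U) \<and> (\<forall>a. \<forall>u\<in>U. (\<lambda>x. a * u x) \<in> U)"

text \<open>For finite \<open>S\<close> this is the ambient space in which chains live; every
  finiteness of dimension below is derived from it.\<close>

definition supp_in :: "'a set \<Rightarrow> ('a \<Rightarrow> 'f::field) set" where
  "supp_in S = {c. \<forall>x. x \<notin> S \<longrightarrow> c x = 0}"

lemma fun_subspace_supp_in: "fun_subspace (supp_in S)"
  by (auto simp: fun_subspace_def supp_in_def)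

lemma fun_subspace_Int: "fun_subspace U \<Longrightarrow> fun_subspace W \<Longrightarrow> fun_subspace (U \<inter> W)"
  by (auto simp: fun_subspace_def)

lemma fun_subspaceD:
  assumes "fun_subspace U"
  shows "0 \<in> U" "u \<in> U \<Longrightarrow> v \<in> U \<Longrightarrow> u + v \<in> U" "u \<in> U \<Longrightarrow> (\<lambda>x. a * u x) \<in> U"
    "u \<in> U \<Longrightarrow> - u \<in> U" "u \<in> U \<Longrightarrow> v \<in> U \<Longrightarrow> u - v \<in> U"
proof -
  show *: "0 \<in> U" "\<And>u v. u \<in> U \<Longrightarrow> v \<in> U \<Longrightarrow> u + v \<in> U" "\<And>a u. u \<in> U \<Longrightarrow> (\<lambda>x. a * u x) \<in> U"
    using assms unfolding fun_subspace_def by auto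
  have neg: "- u \<in> U" if "u \<in> U" for u
    using *(3)[of u "-1"] that by (simp add: fun_Compl_def)
  then show "u \<in> U \<Longrightarrow> - u \<in> U" .
  show "u - v \<in> U" if "u \<in> U" "v \<in> U"
    using *(2)[OF that(1) neg[OF that(2)]] by simp
qed

section \<open>Arithmetic of cosets\<close>

lemma fun_subspace_plus_absorb:
  assumes "fun_subspace U" "fun_subspace U'" "U \<subseteq> U'"
  shows "U + U' = U'"
proof
  show "U + U' \<subseteq> U'"
    using assms fun_subspaceD(2)[OF assms(2)] by (auto simp: set_plus_def)
  show "U' \<subseteq> U + U'"
    using set_zero_plus2[OF fun_subspaceD(1)[OF assms(1)]] .
qed

lemma coset_eq_iff:
  assumes "fun_subspace U"
  shows "w +o U = w' +o U \<longleftrightarrow> w - w' \<in> U"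
proof
  assume "w +o U = w' +o U"
  moreover have "w \<in> w +o U"
    using fun_subspaceD(1)[OF assms] by (auto simp: elt_set_plus_def intro!: bexI[of _ 0])
  ultimately show "w - w' \<in> U"
    by (auto simp: elt_set_plus_def)
next
  assume d: "w - w' \<in> U"
  have "w +o U \<subseteq> w' +o U" if "w - w' \<in> U" for w w'
  proof
    fix c assume "c \<in> w +o U"
    then obtain u where u: "u \<in> U" "c = w + u" by (auto simp: elt_set_plus_def)
    then have "c = w' + ((w - w') + u)" by simp
    then show "c \<in> w' +o U"
      using fun_subspaceD(2)[OF assms that u(1)] unfolding elt_set_plus_def by blast
  qed
  from this[OF d] this[of w' w] show "w +o U = w' +o U"
    using fun_subspaceD(4)[OF assms d] by auto
qed

lemma coset_add:
  assumes "fun_subspace U"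
  shows "(w +o U) + (w' +o U) = (w + w') +o U"
  using fun_subspace_plus_absorb[OF assms assms] by (simp add: set_plus_rearrange)

lemma coset_smult:
  assumes "fun_subspace U"
  shows "(\<lambda>w x. a * w x) ` (w +o U) + U = (\<lambda>x. a * w x) +o U"
proof
  show "(\<lambda>w x. a * w x) ` (w +o U) + U \<subseteq> (\<lambda>x. a * w x) +o U"
  proof
    fix c assume "c \<in> (\<lambda>w x. a * w x) ` (w +o U) + U"
    then obtain u v where uv: "u \<in> U" "v \<in> U" "c = (\<lambda>x. a * (w + u) x) + v"
      by (auto simp: set_plus_def elt_set_plus_def)
    then have "c = (\<lambda>x. a * w x) + ((\<lambda>x. a * u x) + v)"
      by (auto simp: fun_eq_iff algebra_simps)
    then show "c \<in> (\<lambda>x. a * w x) +o U"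
      using fun_subspaceD(2,3)[OF assms] uv unfolding elt_set_plus_def by blast
  qed
  show "(\<lambda>x. a * w x) +o U \<subseteq> (\<lambda>w x. a * w x) ` (w +o U) + U"
  proof
    fix c assume "c \<in> (\<lambda>x. a * w x) +o U"
    then obtain u where u: "u \<in> U" "c = (\<lambda>x. a * w x) + u"
      by (auto simp: elt_set_plus_def)
    have "w \<in> w +o U"
      using fun_subspaceD(1)[OF assms] by (auto simp: elt_set_plus_def intro!: bexI[of _ 0])
    then have "(\<lambda>x. a * w x) \<in> (\<lambda>w x. a * w x) ` (w +o U)" by blast
    with u show "c \<in> (\<lambda>w x. a * w x) ` (w +o U) + U"
      unfolding set_plus_def by blast
  qed
qed

text \<open>Identifies adding the larger denominator to a coset, as \<open>induced_map\<close> does,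
  with the canonical projection between quotients.\<close>

lemma coset_plus_larger:
  assumes "fun_subspace U" "fun_subspace U'" "U \<subseteq> U'"
  shows "(w +o U) + U' = w +o U'"
  using fun_subspace_plus_absorb[OF assms] set_plus_rearrange3[of w U U'] by simp

lemma quotient_space_sel [simp]:
  "carrier (quotient_space W U) = (\<lambda>w. w +o U) ` W"
  "zero (quotient_space W U) = U"
  "add (quotient_space W U) = (+)"
  "smult (quotient_space W U) = (\<lambda>a A. (\<lambda>w x. a * w x) ` A + U)"
  by (simp_all add: quotient_space_def)

text \<open>Turns the record update in \<open>homology_rank\<close>, and the subspaces
  \<open>vs W\<close>, back into quotient spaces.\<close>

lemma quotient_space_carrier_update [simp]:
  "quotient_space W U \<lparr>carrier := (\<lambda>w. w +o U) ` A\<rparr> = quotient_space A U"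
  by (simp add: quotient_space_def)

lemma vectorspace_quotient_space:
  fixes W :: "('a \<Rightarrow> 'f::field) set"
  assumes W: "fun_subspace W" and U: "fun_subspace U"
  shows "vectorspace class_ring (quotient_space W U)"
proof (rule vs_criteria)
  note D = fun_subspaceD[OF W]
  note C = coset_add[OF U] coset_smult[OF U]
  have U0: "U = 0 +o U" by simp
  show "field (class_ring :: 'f ring)" by (rule class_field)
  show "\<zero>\<^bsub>quotient_space W U\<^esub> \<in> carrier (quotient_space W U)"
    using D(1) U0 by (auto simp del: set_zero_plus)
  show "\<forall>v w. v \<in> carrier (quotient_space W U) \<and> w \<in> carrier (quotient_space W U) \<longrightarrow>
     v \<oplus>\<^bsub>quotient_space W U\<^esub> w \<in> carrier (quotient_space W U)"
    using D(2) by (auto simp: C)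
  show "\<forall>v\<in>carrier (quotient_space W U). \<exists>neg_v\<in>carrier (quotient_space W U).
     v \<oplus>\<^bsub>quotient_space W U\<^esub> neg_v = \<zero>\<^bsub>quotient_space W U\<^esub>"
    using D(4) by (auto simp: C intro!: bexI[of _ "- _"])
  show "\<forall>c v. c \<in> carrier class_ring \<and> v \<in> carrier (quotient_space W U) \<longrightarrow>
     c \<odot>\<^bsub>quotient_space W U\<^esub> v \<in> carrier (quotient_space W U)"
    using D(3) by (auto simp: C)
  show "\<forall>v w. v \<in> carrier (quotient_space W U) \<and> w \<in> carrier (quotient_space W U) \<longrightarrow>
     v \<oplus>\<^bsub>quotient_space W U\<^esub> w = w \<oplus>\<^bsub>quotient_space W U\<^esub> v"
    by (simp add: add.commute)
  show "\<forall>v w x. v \<in> carrier (quotient_space W U) \<and> w \<in> carrier (quotient_space W U) \<and>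
     x \<in> carrier (quotient_space W U) \<longrightarrow>
     v \<oplus>\<^bsub>quotient_space W U\<^esub> w \<oplus>\<^bsub>quotient_space W U\<^esub> x =
     v \<oplus>\<^bsub>quotient_space W U\<^esub> (w \<oplus>\<^bsub>quotient_space W U\<^esub> x)"
    by (simp add: add.assoc)
  have "(w +o U) + U = w +o U" for w
    using C(1)[of w 0] by simp
  then show "\<forall>v\<in>carrier (quotient_space W U). v \<oplus>\<^bsub>quotient_space W U\<^esub> \<zero>\<^bsub>quotient_space W U\<^esub> = v"
    by auto

  show "\<forall>a b v. a \<in> carrier class_ring \<and> b \<in> carrier class_ring \<and> v \<in> carrier (quotient_space W U) \<longrightarrow>
     (a \<otimes>\<^bsub>class_ring\<^esub> b) \<odot>\<^bsub>quotient_space W U\<^esub> v =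
     a \<odot>\<^bsub>quotient_space W U\<^esub> (b \<odot>\<^bsub>quotient_space W U\<^esub> v)"
    by (clarsimp simp: C) (simp add: mult.assoc)
  show "\<forall>v\<in>carrier (quotient_space W U). \<one>\<^bsub>class_ring\<^esub> \<odot>\<^bsub>quotient_space W U\<^esub> v = v"
    using C(2)[of 1] by auto
  show "\<forall>a b v. a \<in> carrier class_ring \<and> b \<in> carrier class_ring \<and> v \<in> carrier (quotient_space W U) \<longrightarrow>
     (a \<oplus>\<^bsub>class_ring\<^esub> b) \<odot>\<^bsub>quotient_space W U\<^esub> v =
     a \<odot>\<^bsub>quotient_space W U\<^esub> v \<oplus>\<^bsub>quotient_space W U\<^esub> b \<odot>\<^bsub>quotient_space W U\<^esub> v"
    by (clarsimp simp: C) (simp add: plus_fun_def distrib_right)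
  show "\<forall>a v w. a \<in> carrier class_ring \<and> v \<in> carrier (quotient_space W U) \<and> w \<in> carrier (quotient_space W U) \<longrightarrow>
     a \<odot>\<^bsub>quotient_space W U\<^esub> (v \<oplus>\<^bsub>quotient_space W U\<^esub> w) =
     a \<odot>\<^bsub>quotient_space W U\<^esub> v \<oplus>\<^bsub>quotient_space W U\<^esub> a \<odot>\<^bsub>quotient_space W U\<^esub> w"
    by (clarsimp simp: C) (simp add: plus_fun_def distrib_left)
qed

text \<open>The cosets of the indicators of the points of \<open>S\<close> span the quotient:
  induction on the support splits off the value at one point.\<close>

lemma finite_dimensional_quotient_supp_in:
  fixes U :: "('a \<Rightarrow> 'f::field) set"
  assumes S: "finite S" and U: "fun_subspace U"
  shows "vectorspace.fin_dim class_ring (quotient_space (supp_in S) U)"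
proof -
  let ?Q = "quotient_space (supp_in S) U"
  interpret V: vectorspace class_ring ?Q
    by (rule vectorspace_quotient_space[OF fun_subspace_supp_in U])
  define B where "B = (\<lambda>v. (\<lambda>x. if x = v then 1 else 0) +o U) ` S"
  have B: "finite B" "B \<subseteq> carrier ?Q"
    using S by (auto simp: B_def supp_in_def)
  interpret sp: submodule class_ring "V.span B" ?Q
    by (rule V.span_is_submodule[OF B(2)])
  have "c +o U \<in> V.span B" if "T \<subseteq> S" "c \<in> supp_in T" for T c
    using finite_subset[OF that(1) S] that
  proof (induction T arbitrary: c rule: finite_induct)
    case empty
    then have "c = 0" by (auto simp: supp_in_def fun_eq_iff)
    then have "c +o U = U" by (simp only: set_zero_plus)
    then show ?case using sp.zero_closed by simp
  next
    case (insert v T)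
    let ?e = "(\<lambda>x. if x = v then 1 else 0) :: 'a \<Rightarrow> 'f"
    have "?e +o U \<in> V.span B"
      using insert.prems V.in_own_span[OF B(2)] by (auto simp: B_def)
    then have "(\<lambda>x. c v * ?e x) +o U \<in> V.span B"
      using sp.smult_closed[of "c v" "?e +o U"] by (simp add: coset_smult[OF U] del: mult.commute)
    moreover have "(\<lambda>x. if x = v then 0 else c x) +o U \<in> V.span B"
      using insert.prems by (intro insert.IH) (auto simp: supp_in_def)
    ultimately have "((\<lambda>x. c v * ?e x) + (\<lambda>x. if x = v then 0 else c x)) +o U \<in> V.span B"
      using sp.m_closed by (fastforce simp: coset_add[OF U])
    moreover have "(\<lambda>x. c v * ?e x) + (\<lambda>x. if x = v then 0 else c x) = c"
      by (auto simp: fun_eq_iff)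
    ultimately show ?case by simp
  qed
  then have "V.span B = carrier ?Q"
    using sp.subset by auto
  then show ?thesis
    unfolding V.fin_dim_def using B by blast
qed

text \<open>Independent subsets of \<open>W\<close> stay independent in \<open>V\<close>, so
  \<open>dim\<close> bounds their size; a maximal one exists and is a basis.\<close>

lemma (in vectorspace) subspace_fin_dim:
  assumes "fin_dim" "subspace K W V"
  shows "vectorspace.fin_dim K (vs W)"
proof -
  interpret W: vectorspace K "vs W"
    by (rule subspace_is_vs[OF assms(2)])
  have sub: "submodule K W V" using assms(2) by (rule is_module)
  have WV: "W \<subseteq> carrier V" using sub by (simp add: submodule_def)
  let ?P = "\<lambda>S. S \<subseteq> carrier (vs W) \<and> W.lin_indpt S"
  have li: "lin_indpt S" if "?P S" for S
    using that span_li_not_depend(2)[OF _ sub, of S] by simp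
  have "finite S \<and> card S \<le> dim" if "?P S" for S
    using li_le_dim[OF assms(1), of S] li[OF that] that WV by auto
  moreover have "?P {}"
    by (auto simp: W.lin_dep_def)
  ultimately obtain A where "finite A" "maximal A ?P"
    using maximal_exists[of ?P dim "{}"] by blast
  then show ?thesis
    unfolding W.fin_dim_def using W.max_li_is_basis[of A] by (auto simp: W.basis_def)
qed

section \<open>Dimensions of quotients\<close>

lemma subspace_quotient_space:
  assumes "fun_subspace A" "fun_subspace W" "fun_subspace U" "A \<subseteq> W"
  shows "subspace class_ring ((\<lambda>w. w +o U) ` A) (quotient_space W U)"
proof (intro subspace.intro submodule.intro)
  show "vectorspace class_ring (quotient_space W U)"
    by (rule vectorspace_quotient_space[OF assms(2,3)])
  then show "module class_ring (quotient_space W U)"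
    by (simp add: vectorspace_def)
  show "\<zero>\<^bsub>quotient_space W U\<^esub> \<in> (\<lambda>w. w +o U) ` A"
    using fun_subspaceD(1)[OF assms(1)] by (auto intro!: image_eqI[of _ _ 0])
  show "v \<oplus>\<^bsub>quotient_space W U\<^esub> w \<in> (\<lambda>w. w +o U) ` A"
    if "v \<in> (\<lambda>w. w +o U) ` A" "w \<in> (\<lambda>w. w +o U) ` A" for v w
    using that fun_subspaceD(2)[OF assms(1)] by (auto simp: coset_add[OF assms(3)])
  show "c \<odot>\<^bsub>quotient_space W U\<^esub> v \<in> (\<lambda>w. w +o U) ` A"
    if "c \<in> carrier class_ring" "v \<in> (\<lambda>w. w +o U) ` A" for c v
    using that fun_subspaceD(3)[OF assms(1)] by (auto simp: coset_smult[OF assms(3)])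
qed (use assms in auto)

text \<open>The carrier holds the cosets of elements of \<open>W\<close> only, so this is the
  dimension of (W + U) / U. For the cycles of a subcomplex and the boundaries of the larger complex
  it is a persistent Betti number.\<close>

abbreviation qdim :: "('a \<Rightarrow> 'f::field) set \<Rightarrow> ('a \<Rightarrow> 'f) set \<Rightarrow> nat" where
  "qdim W U \<equiv> vectorspace.dim (class_ring :: 'f ring) (quotient_space W U)"

lemma fin_dim_quotient_space:
  assumes "finite S" "W \<subseteq> supp_in S" "fun_subspace W" "fun_subspace U"
  shows "vectorspace.fin_dim class_ring (quotient_space W U)"
  using vectorspace.subspace_fin_dim[OF vectorspace_quotient_space[OF fun_subspace_supp_in assms(4)]
      finite_dimensional_quotient_supp_in[OF assms(1,4)]
      subspace_quotient_space[OF assms(3) fun_subspace_supp_in assms(4,2)]]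
  by simp

lemma qdim_mono:
  assumes "finite S" "W \<subseteq> supp_in S" "fun_subspace A" "fun_subspace W" "fun_subspace U" "A \<subseteq> W"
  shows "qdim A U \<le> qdim W U"
  using vectorspace.subspace_dim[OF vectorspace_quotient_space[OF assms(4,5)]
      subspace_quotient_space[OF assms(3-6)] fin_dim_quotient_space[OF assms(1,2,4,5)]]
    fin_dim_quotient_space[OF assms(1) order_trans[OF assms(6,2)] assms(3,5)]
  by simp

text \<open>Rank-nullity for the projection \<open>W / U \<rightarrow> W / U'\<close>.\<close>

lemma qdim_larger_denominator:
  fixes W :: "('a \<Rightarrow> 'f::field) set"
  assumes "finite S" "W \<subseteq> supp_in S" "fun_subspace W" "fun_subspace U" "fun_subspace U'" "U \<subseteq> U'"
  shows "qdim W U' + qdim (W \<inter> U') U = qdim W U"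
proof -
  let ?R = "class_ring :: 'f ring" and ?V = "quotient_space W U" and ?W = "quotient_space W U'"
  note larger = coset_plus_larger[OF assms(4-6)]
  have "(\<lambda>A. A + U') \<in> module_hom ?R ?V ?W"
    by (auto simp: module_hom_def larger coset_add[OF assms(4)] coset_add[OF assms(5)]
        coset_smult[OF assms(4)] coset_smult[OF assms(5)])
  then interpret T: linear_map ?R ?V ?W "\<lambda>A. A + U'"
    using vectorspace_quotient_space[OF assms(3,4)] vectorspace_quotient_space[OF assms(3,5)]
    by (simp add: linear_map_def mod_hom_def mod_hom_axioms_def vectorspace_def)
  have im: "T.im = (\<lambda>w. w +o U') ` W"
    by (auto simp: T.im_def larger image_image)
  have trivial: "w +o U' = U' \<longleftrightarrow> w \<in> U'" for w
    using coset_eq_iff[OF assms(5), of w 0] by simp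
  have "T.ker = {A \<in> (\<lambda>w. w +o U) ` W. A + U' = U'}"
    by (simp add: T.ker_def)
  also have "\<dots> = (\<lambda>w. w +o U) ` {w \<in> W. (w +o U) + U' = U'}"
    by blast
  finally have ker: "T.ker = (\<lambda>w. w +o U) ` (W \<inter> U')"
    by (simp add: larger trivial Int_def)
  show ?thesis
    using T.rank_nullity[OF fin_dim_quotient_space[OF assms(1-4)]] by (simp add: im ker)
qed

text \<open>By rank-nullity, passing from \<open>U\<close> to \<open>U'\<close> costs a numerator
  \<open>W\<close> the dimension of \<open>W \<inter> U'\<close> modulo \<open>U\<close>, and this
  loss is monotone in the numerator.\<close>

lemma qdim_exchange:
  assumes "finite S" "W \<subseteq> supp_in S" "fun_subspace A" "fun_subspace W"
    "fun_subspace U" "fun_subspace U'" "A \<subseteq> W" "U \<subseteq> U'"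
  shows "qdim W U' + qdim A U \<le> qdim A U' + qdim W U"
proof -
  note sub = fun_subspace_Int[OF _ assms(6)]
  have "qdim (A \<inter> U') U \<le> qdim (W \<inter> U') U"
    using assms by (intro qdim_mono[OF assms(1)] sub) auto
  moreover have "qdim A U' + qdim (A \<inter> U') U = qdim A U"
    using assms by (intro qdim_larger_denominator[OF assms(1)]) auto
  moreover have "qdim W U' + qdim (W \<inter> U') U = qdim W U"
    using assms by (intro qdim_larger_denominator[OF assms(1)]) auto
  ultimately show ?thesis by linarith
qed

lemma qdim_zero_numerator:
  assumes "fun_subspace U"
  shows "qdim {0} U = 0"
proof -
  have z: "fun_subspace {0}" by (auto simp: fun_subspace_def fun_eq_iff)
  have "{0} \<subseteq> supp_in {}" by (auto simp: supp_in_def)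
  \<comment> \<open>With both denominators equal to \<open>U\<close>, rank-nullity for the numerator
    \<open>{0}\<close> reads d + d = d.\<close>
  from qdim_larger_denominator[OF _ this z assms assms] show ?thesis
    using fun_subspaceD(1)[OF assms] by simp
qed

section \<open>Ranks in simplicial homology\<close>

lemma chains_eq_supp_in: "chains X n = supp_in {\<sigma> \<in> X. card \<sigma> = Suc n}"
  by (auto simp: chains_def supp_in_def)

lemma boundary_add: "boundary X (c + d) = boundary X c + boundary X d"
proof
  fix \<tau> :: "nat set"
  let ?t = "\<lambda>c (\<sigma> :: nat set) v. if \<sigma> - {v} = \<tau> then (-1) ^ card {u\<in>\<sigma>. u < v} * c \<sigma> else 0"
  have "?t (c + d) \<sigma> v = ?t c \<sigma> v + ?t d \<sigma> v" for \<sigma> v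
    by (simp add: distrib_left)
  then show "boundary X (c + d) \<tau> = (boundary X c + boundary X d) \<tau>"
    unfolding boundary_def by (simp only: sum.distrib plus_fun_apply) simp
qed

lemma boundary_smult: "boundary X (\<lambda>\<sigma>. a * c \<sigma>) = (\<lambda>\<tau>. a * boundary X c \<tau>)"
proof
  fix \<tau> :: "nat set"
  let ?t = "\<lambda>c (\<sigma> :: nat set) v. if \<sigma> - {v} = \<tau> then (-1) ^ card {u\<in>\<sigma>. u < v} * c \<sigma> else 0"
  have "?t (\<lambda>\<sigma>. a * c \<sigma>) \<sigma> v = a * ?t c \<sigma> v" for \<sigma> v
    by simp
  then show "boundary X (\<lambda>\<sigma>. a * c \<sigma>) \<tau> = a * boundary X c \<tau>"
    unfolding boundary_def by (simp only: sum_distrib_left[symmetric]) simp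
qed

lemma boundary_zero: "boundary X 0 = 0"
  by (simp add: boundary_def fun_eq_iff cong: if_cong)

lemma fun_subspace_cycles: "fun_subspace (cycles X n)"
proof -
  note C = fun_subspaceD(1-3)[OF fun_subspace_supp_in[of "{\<sigma> \<in> X. card \<sigma> = Suc n}"],
      folded chains_eq_supp_in]
  show ?thesis
    unfolding fun_subspace_def cycles_def
  proof (intro conjI ballI allI)
    show "0 \<in> {c \<in> chains X n. boundary X c = 0}"
      using C(1) boundary_zero by blast
    show "u + v \<in> {c \<in> chains X n. boundary X c = 0}"
      if "u \<in> {c \<in> chains X n. boundary X c = 0}" "v \<in> {c \<in> chains X n. boundary X c = 0}" for u v
      using that by (simp add: C(2) boundary_add)
    show "(\<lambda>x. a * u x) \<in> {c \<in> chains X n. boundary X c = 0}"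
      if "u \<in> {c \<in> chains X n. boundary X c = 0}" for a u
      using that by (simp add: C(3) boundary_smult zero_fun_def)
  qed
qed

lemma fun_subspace_boundaries: "fun_subspace (boundaries X n)"
proof -
  note C = fun_subspaceD(1-3)[OF fun_subspace_supp_in[of "{\<sigma> \<in> X. card \<sigma> = Suc (Suc n)}"],
      folded chains_eq_supp_in]
  show ?thesis
    unfolding fun_subspace_def boundaries_def
  proof (intro conjI ballI allI)
    show "0 \<in> boundary X ` chains X (Suc n)"
      by (rule image_eqI[of _ _ 0]) (simp_all only: boundary_zero C(1))
    show "u + v \<in> boundary X ` chains X (Suc n)"
      if "u \<in> boundary X ` chains X (Suc n)" "v \<in> boundary X ` chains X (Suc n)" for u v
      using that by (elim imageE) (simp only: boundary_add[symmetric] C(2) image_eqI)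
    show "(\<lambda>x. a * u x) \<in> boundary X ` chains X (Suc n)"
      if "u \<in> boundary X ` chains X (Suc n)" for a u
      using that by (elim imageE) (simp only: boundary_smult[symmetric] C(3) image_eqI)
  qed
qed

text \<open>The complex enters \<open>boundary\<close> only as the range of summation, and a chain
  vanishes off its own complex. Hence the inclusion of chains commutes with the boundary.\<close>

lemma boundary_mono:
  assumes "finite Y" "X \<subseteq> Y" "c \<in> chains X n"
  shows "boundary Y c = boundary X c"
proof
  fix \<tau> :: "nat set"
  have 0: "c \<sigma> = 0" if "\<sigma> \<in> Y - X" for \<sigma>
    using that assms(3) by (simp add: chains_def)
  have "(\<Sum>\<sigma>\<in>Y. \<Sum>v\<in>\<sigma>. if \<sigma> - {v} = \<tau> then (-1) ^ card {u\<in>\<sigma>. u < v} * c \<sigma> else 0) =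
      (\<Sum>\<sigma>\<in>X. \<Sum>v\<in>\<sigma>. if \<sigma> - {v} = \<tau> then (-1) ^ card {u\<in>\<sigma>. u < v} * c \<sigma> else 0)"
    by (intro sum.mono_neutral_right assms ballI sum.neutral) (simp add: 0)
  then show "boundary Y c \<tau> = boundary X c \<tau>"
    by (simp add: boundary_def)
qed

lemma chains_mono: "X \<subseteq> Y \<Longrightarrow> chains X n \<subseteq> chains Y n"
  by (auto simp: chains_def)

lemma cycles_mono:
  assumes "finite Y" "X \<subseteq> Y"
  shows "cycles X n \<subseteq> cycles Y n"
  by (auto simp: cycles_def boundary_mono[OF assms] intro: subsetD[OF chains_mono[OF assms(2)]])

lemma boundaries_mono:
  assumes "finite Y" "X \<subseteq> Y"
  shows "boundaries X n \<subseteq> boundaries Y n"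
  using chains_mono[OF assms(2), of "Suc n"] boundary_mono[OF assms, of _ "Suc n"]
  unfolding boundaries_def by (metis (no_types, lifting) image_cong image_mono)

lemma cycles_supp_in: "cycles X n \<subseteq> supp_in X"
  by (auto simp: cycles_def chains_def supp_in_def)

text \<open>The image of the induced map consists of the classes of cycles of \<open>X\<close>
  modulo the boundaries of \<open>Y\<close>: the smaller complex sets the numerator, the larger one
  the denominator.\<close>

lemma homology_rank_eq_qdim:
  fixes K :: "'f::field itself"
  assumes "finite Y" "X \<subseteq> Y"
  shows "homology_rank K n X Y = qdim (cycles X n :: (_ \<Rightarrow> 'f) set) (boundaries Y n)"
proof -
  have "induced_map Y n ` carrier (homology X n :: ('f, _) module) =
      (\<lambda>w. w +o boundaries Y n) ` cycles X n"
    by (simp add: homology_def induced_map_def image_image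
        coset_plus_larger[OF fun_subspace_boundaries fun_subspace_boundaries boundaries_mono[OF assms]])
  then show ?thesis
    by (simp add: homology_rank_def homology_def)
qed

lemma homology_rank_mono:
  assumes "finite Z" "X \<subseteq> Y" "Y \<subseteq> Z"
  shows "homology_rank K n X Z \<le> homology_rank K n Y Z"
proof -
  have Y: "finite Y" and XZ: "X \<subseteq> Z" using assms finite_subset by auto
  show ?thesis
    unfolding homology_rank_eq_qdim[OF assms(1) XZ] homology_rank_eq_qdim[OF assms(1,3)]
    by (rule qdim_mono[OF Y cycles_supp_in fun_subspace_cycles fun_subspace_cycles
          fun_subspace_boundaries cycles_mono[OF Y assms(2)]])
qed

text \<open>Between \<open>Z\<close> and \<open>T\<close> the classes coming from \<open>X\<close>
  lose at most as much rank as those coming from \<open>Y\<close>.\<close>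

lemma homology_rank_exchange:
  assumes "finite T" "X \<subseteq> Y" "Y \<subseteq> Z" "Z \<subseteq> T"
  shows "homology_rank K n Y T + homology_rank K n X Z \<le> homology_rank K n X T + homology_rank K n Y Z"
proof -
  have Y: "finite Y" and Z: "finite Z" and sub: "X \<subseteq> Z" "X \<subseteq> T" "Y \<subseteq> T"
    using assms finite_subset[of _ T] by auto
  show ?thesis
    unfolding homology_rank_eq_qdim[OF assms(1) sub(2)] homology_rank_eq_qdim[OF assms(1) sub(3)]
      homology_rank_eq_qdim[OF Z sub(1)] homology_rank_eq_qdim[OF Z assms(3)]
    by (rule qdim_exchange[OF Y cycles_supp_in fun_subspace_cycles fun_subspace_cycles
          fun_subspace_boundaries fun_subspace_boundaries cycles_mono[OF Y assms(2)]
          boundaries_mono[OF assms(1,4)]])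
qed

lemma homology_rank_empty:
  fixes K :: "'f::field itself"
  assumes "finite X"
  shows "homology_rank K n {} X = 0"
proof -
  have "c = 0" if "c \<in> chains {} n" for c :: "nat set \<Rightarrow> 'f"
    using that by (simp add: chains_def fun_eq_iff)
  then have "cycles {} n = {0 :: nat set \<Rightarrow> 'f}"
    using fun_subspaceD(1)[OF fun_subspace_cycles] by (auto simp: cycles_def)
  then show ?thesis
    using assms by (simp add: homology_rank_eq_qdim qdim_zero_numerator[OF fun_subspace_boundaries])
qed

section \<open>Matchings of diagrams\<close>

text \<open>Unlike a bound on the infimum, this asks for one bijection that achieves
  \<open>e\<close>, so matchings can be composed.\<close>

definition matched :: "ereal \<Rightarrow> diagram \<Rightarrow> diagram \<Rightarrow> bool" where
  "matched e D D' \<longleftrightarrow> (\<exists>\<gamma>. bij_betw \<gamma> (diagram_points D) (diagram_points D') \<and>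
     (\<forall>y\<in>diagram_points D. linf_dist (fst y) (fst (\<gamma> y)) \<le> e))"

lemma bottleneck_dist_le_matched: "matched e D D' \<Longrightarrow> bottleneck_dist D D' \<le> e"
  unfolding matched_def bottleneck_dist_def by (auto intro!: INF_lower2 SUP_least)

section \<open>Triangle inequality and composition of matchings\<close>

lemma death_dist_triangle: "death_dist a c \<le> death_dist a b + death_dist b c"
  by (cases a; cases b; cases c) (auto simp: death_dist_def)

lemma linf_dist_triangle: "linf_dist x z \<le> linf_dist x y + linf_dist y z"
proof -
  obtain b1 d1 b2 d2 b3 d3 where [simp]: "x = (b1, d1)" "y = (b2, d2)" "z = (b3, d3)"
    by (metis surj_pair)
  have "ereal \<bar>b1 - b3\<bar> \<le> ereal \<bar>b1 - b2\<bar> + ereal \<bar>b2 - b3\<bar>"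
    by simp
  also have "\<dots> \<le> linf_dist x y + linf_dist y z"
    by (intro add_mono) auto
  finally have 1: "ereal \<bar>b1 - b3\<bar> \<le> linf_dist x y + linf_dist y z" .
  have "death_dist d1 d3 \<le> death_dist d1 d2 + death_dist d2 d3"
    by (rule death_dist_triangle)
  also have "\<dots> \<le> linf_dist x y + linf_dist y z"
    by (intro add_mono) auto
  finally show ?thesis
    using 1 by simp
qed

lemma matched_trans:
  assumes "matched a D E" "matched b E F"
  shows "matched (a + b) D F"
proof -
  obtain \<gamma> \<delta> where \<gamma>: "bij_betw \<gamma> (diagram_points D) (diagram_points E)"
      "\<forall>y\<in>diagram_points D. linf_dist (fst y) (fst (\<gamma> y)) \<le> a"
    and \<delta>: "bij_betw \<delta> (diagram_points E) (diagram_points F)"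
      "\<forall>y\<in>diagram_points E. linf_dist (fst y) (fst (\<delta> y)) \<le> b"
    using assms unfolding matched_def by blast
  have "linf_dist (fst y) (fst ((\<delta> \<circ> \<gamma>) y)) \<le> a + b" if "y \<in> diagram_points D" for y
  proof -
    have "\<gamma> y \<in> diagram_points E" using \<gamma>(1) that by (auto simp: bij_betw_def)
    then have "linf_dist (fst y) (fst (\<gamma> y)) + linf_dist (fst (\<gamma> y)) (fst (\<delta> (\<gamma> y))) \<le> a + b"
      using \<gamma>(2) \<delta>(2) that by (intro add_mono) auto
    then show ?thesis
      using linf_dist_triangle order_trans unfolding comp_def by blast
  qed
  then show ?thesis
    unfolding matched_def using bij_betw_trans[OF \<gamma>(1) \<delta>(1)] by blast
qed

text \<open>The bijections of the fibres are glued: the first component of the image is the diagram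
  point, the second the copy number chosen in its fibre.\<close>

lemma diagram_points_fibrewise_bij:
  assumes "\<And>y. \<exists>\<beta>. bij_betw \<beta> {s \<in> S. P s = y} {r. enat r < D y}"
  shows "\<exists>\<alpha>. bij_betw \<alpha> S (diagram_points D) \<and> (\<forall>s\<in>S. fst (\<alpha> s) = P s)"
proof -
  obtain \<beta> where \<beta>: "\<And>y. bij_betw (\<beta> y) {s \<in> S. P s = y} {r. enat r < D y}"
    using assms by metis
  let ?\<alpha> = "\<lambda>s. (P s, \<beta> (P s) s)"
  have "bij_betw ?\<alpha> S (diagram_points D)"
    unfolding bij_betw_def
  proof
    show "inj_on ?\<alpha> S"
    proof (rule inj_onI)
      fix s t assume "s \<in> S" "t \<in> S" "?\<alpha> s = ?\<alpha> t"
      then have "P t = P s" "\<beta> (P s) s = \<beta> (P s) t" by (metis Pair_inject)+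
      with \<open>s \<in> S\<close> \<open>t \<in> S\<close> show "s = t"
        using inj_onD[OF bij_betw_imp_inj_on[OF \<beta>[of "P s"]], of s t] by simp
    qed
    show "?\<alpha> ` S = diagram_points D"
    proof
      show "?\<alpha> ` S \<subseteq> diagram_points D"
        using \<beta> by (fastforce simp: diagram_points_def bij_betw_def)
      show "diagram_points D \<subseteq> ?\<alpha> ` S"
      proof
        fix z assume "z \<in> diagram_points D"
        then obtain y r where z: "z = (y, r)" "enat r < D y" by (auto simp: diagram_points_def)
        then have "r \<in> \<beta> y ` {s \<in> S. P s = y}" using \<beta>[of y] by (auto simp: bij_betw_def)
        then show "z \<in> ?\<alpha> ` S" using z by auto
      qed
    qed
  qed
  then show ?thesis by auto
qed

text \<open>\<open>Q\<close> indexes bars and \<open>p\<close> gives their positions. A bar placed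
  on the diagonal leaves no trace, since diagonal points have infinite multiplicity anyway.\<close>

definition is_diagram_of :: "'q set \<Rightarrow> ('q \<Rightarrow> real \<times> ereal) \<Rightarrow> diagram \<Rightarrow> bool" where
  "is_diagram_of Q p D \<longleftrightarrow>
     D = (\<lambda>y. if snd y = ereal (fst y) then \<infinity> else enat (card {q \<in> Q. p q = y}))"

text \<open>Each diagonal point \<open>(b, b)\<close> is added once for every natural number.\<close>

abbreviation padded :: "'q set \<Rightarrow> ('q + real \<times> nat) set" where
  "padded Q \<equiv> Inl ` Q \<union> range Inr"

text \<open>Off the diagonal both fibres are finite of the same size. Over a diagonal point the
  padding makes the fibre countably infinite, and finitely many collapsed bars do not change
  that.\<close>

lemma padded_bij_diagram_points:
  assumes "finite Q" "is_diagram_of Q p D"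
  shows "\<exists>\<alpha>. bij_betw \<alpha> (padded Q) (diagram_points D) \<and>
     (\<forall>s\<in>padded Q. fst (\<alpha> s) = case_sum p (\<lambda>(b, k). (b, ereal b)) s)"
proof (rule diagram_points_fibrewise_bij)
  fix y :: "real \<times> ereal"
  let ?F = "{s \<in> padded Q. case_sum p (\<lambda>(b, k). (b, ereal b)) s = y}"
  obtain b d where y: "y = (b, d)" by fastforce
  show "\<exists>\<beta>. bij_betw \<beta> ?F {r. enat r < D y}"
  proof (cases "d = ereal b")
    case True
    have sub: "?F \<subseteq> Inl ` Q \<union> Inr ` ({b} \<times> UNIV)"
      using y by auto
    have "countable (Inl ` Q \<union> Inr ` ({b} \<times> (UNIV :: nat set)))"
      using assms(1) by (simp add: countable_finite)
    then have "countable ?F"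
      using countable_subset[OF sub] by blast
    moreover have "Inr ` ({b} \<times> UNIV) \<subseteq> ?F"
      using y True by auto
    moreover have "infinite (Inr ` ({b} \<times> (UNIV :: nat set)))"
      by (simp add: finite_image_iff finite_cartesian_product_iff)
    ultimately have "bij_betw (to_nat_on ?F) ?F UNIV"
      using finite_subset by (intro to_nat_on_infinite) blast+
    moreover have "{r. enat r < D y} = UNIV"
      using True y assms(2) by (simp add: is_diagram_of_def)
    ultimately show ?thesis by auto
  next
    case False
    then have F: "?F = Inl ` {q \<in> Q. p q = y}"
      using y by auto
    have "{r. enat r < D y} = {..<card {q \<in> Q. p q = y}}"
      using False y assms(2) by (auto simp: is_diagram_of_def)
    moreover have "finite ?F" "card ?F = card {q \<in> Q. p q = y}"
      unfolding F using assms(1) by (auto simp: card_image)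
    ultimately show ?thesis
      by (intro finite_same_card_bij) auto
  qed
qed

text \<open>The matching runs through the shared index set: a bar goes from \<open>p q\<close> to
  \<open>p' q\<close>, possibly into or out of the diagonal, and padding points stay fixed.\<close>

lemma matched_common_index:
  assumes Q: "finite Q" "is_diagram_of Q p D" "is_diagram_of Q p' D'"
    and e: "0 \<le> e" "\<And>q. q \<in> Q \<Longrightarrow> linf_dist (p q) (p' q) \<le> e"
  shows "matched e D D'"
proof -
  let ?P = "\<lambda>p. case_sum p (\<lambda>(b, k::nat). (b, ereal b))"
  obtain \<alpha> where \<alpha>: "bij_betw \<alpha> (padded Q) (diagram_points D)" "\<forall>s\<in>padded Q. fst (\<alpha> s) = ?P p s"
    using padded_bij_diagram_points[OF Q(1,2)] by blast
  obtain \<alpha>' where \<alpha>': "bij_betw \<alpha>' (padded Q) (diagram_points D')"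
      "\<forall>s\<in>padded Q. fst (\<alpha>' s) = ?P p' s"
    using padded_bij_diagram_points[OF Q(1,3)] by blast
  let ?\<gamma> = "\<alpha>' \<circ> inv_into (padded Q) \<alpha>"
  have "bij_betw ?\<gamma> (diagram_points D) (diagram_points D')"
    using bij_betw_trans[OF bij_betw_inv_into[OF \<alpha>(1)] \<alpha>'(1)] .
  moreover have "linf_dist (fst y) (fst (?\<gamma> y)) \<le> e" if "y \<in> diagram_points D" for y
  proof -
    have "y \<in> \<alpha> ` padded Q"
      using that by (simp only: bij_betw_imp_surj_on[OF \<alpha>(1)])
    then obtain s where s: "y = \<alpha> s" "s \<in> padded Q"
      by (rule imageE)
    then have inv: "inv_into (padded Q) \<alpha> y = s"
      by (simp only: inv_into_f_f[OF bij_betw_imp_inj_on[OF \<alpha>(1)]])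
    have "linf_dist (?P p s) (?P p' s) \<le> e"
      using s(2) e by (auto simp: death_dist_def zero_ereal_def[symmetric])
    moreover have "fst y = ?P p s"
      using \<alpha>(2) s(2) by (simp only: s(1))
    moreover have "fst (?\<gamma> y) = ?P p' s"
      using \<alpha>'(2) s(2) by (simp only: comp_apply inv)
    ultimately show ?thesis
      by (simp only:)
  qed
  ultimately show ?thesis
    unfolding matched_def by blast
qed

section \<open>Stability for sublevel filtrations\<close>

text \<open>Nonnegativity keeps \<open>nat\<close> from truncating any summand.\<close>

lemma sum_nat_eq:
  fixes F :: "'i \<Rightarrow> int"
  assumes "\<And>i. i \<in> I \<Longrightarrow> 0 \<le> F i"
  shows "(\<Sum>i\<in>I. nat (F i)) = nat (\<Sum>i\<in>I. F i)"
proof -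
  have "int (\<Sum>i\<in>I. nat (F i)) = (\<Sum>i\<in>I. F i)"
    using assms by (simp add: int_sum)
  then show ?thesis by linarith
qed

text \<open>\<open>r A C\<close> stands for the rank of the map from the homology of
  \<open>A\<close> to that of \<open>C\<close>. The inequalities are asked of arbitrary subsets, so
  no interpolated function has to be checked for having subcomplexes as sublevel sets.\<close>

locale rank_function =
  fixes \<Delta> :: "'a set" and r :: "'a set \<Rightarrow> 'a set \<Rightarrow> nat"
  assumes finite_ground: "finite \<Delta>"
    and rank_mono: "A \<subseteq> B \<Longrightarrow> B \<subseteq> C \<Longrightarrow> C \<subseteq> \<Delta> \<Longrightarrow> r A C \<le> r B C"
    and rank_exchange:
      "A \<subseteq> B \<Longrightarrow> B \<subseteq> C \<Longrightarrow> C \<subseteq> D \<Longrightarrow> D \<subseteq> \<Delta> \<Longrightarrow> r B D + r A C \<le> r A D + r B C"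
    and rank_empty: "A \<subseteq> \<Delta> \<Longrightarrow> r {} A = 0"
begin

section \<open>Multiplicities as jumps of ranks across levels\<close>

definition below :: "('a \<Rightarrow> real) \<Rightarrow> real \<Rightarrow> 'a set" where
  "below f t = {x \<in> \<Delta>. f x \<le> t}"

definition sbelow :: "('a \<Rightarrow> real) \<Rightarrow> real \<Rightarrow> 'a set" where
  "sbelow f t = {x \<in> \<Delta>. f x < t}"

definition jump :: "('a \<Rightarrow> real) \<Rightarrow> ('a set \<Rightarrow> int) \<Rightarrow> real \<Rightarrow> int" where
  "jump f G t = G (below f t) - G (sbelow f t)"

definition essential_mult :: "('a \<Rightarrow> real) \<Rightarrow> real \<Rightarrow> int" where
  "essential_mult f b = jump f (\<lambda>A. int (r A \<Delta>)) b"

text \<open>The usual alternating sum of four persistent Betti numbers, written as a mixed second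
  difference so that sums over levels telescope in births and deaths separately.\<close>

definition finite_mult :: "('a \<Rightarrow> real) \<Rightarrow> real \<Rightarrow> real \<Rightarrow> int" where
  "finite_mult f b d = - jump f (\<lambda>A. jump f (\<lambda>B. int (r A B)) d) b"

definition point_mult :: "('a \<Rightarrow> real) \<Rightarrow> real \<times> ereal \<Rightarrow> nat" where
  "point_mult f = (\<lambda>(b, e). case e of
     ereal d \<Rightarrow> if b < d then nat (finite_mult f b d) else 0
   | PInfty \<Rightarrow> nat (essential_mult f b)
   | MInfty \<Rightarrow> 0)"

lemma point_mult_simps [simp]:
  "point_mult f (b, ereal d) = (if b < d then nat (finite_mult f b d) else 0)"
  "point_mult f (b, \<infinity>) = nat (essential_mult f b)"
  "point_mult f (b, -\<infinity>) = 0"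
  by (simp_all add: point_mult_def)

definition filtration_diagram :: "('a \<Rightarrow> real) \<Rightarrow> diagram" where
  "filtration_diagram f = (\<lambda>y. if snd y = ereal (fst y) then \<infinity> else enat (point_mult f y))"

lemma essential_mult_nonneg: "0 \<le> essential_mult f b"
proof -
  have "sbelow f b \<subseteq> below f b" "below f b \<subseteq> \<Delta>"
    by (auto simp: below_def sbelow_def)
  from rank_mono[OF this order_refl] show ?thesis
    by (simp add: essential_mult_def jump_def)
qed

text \<open>\<open>b < d\<close> gives the middle inclusion of the chain of four sublevel sets to
  which the exchange inequality applies.\<close>

lemma finite_mult_nonneg:
  assumes "b < d"
  shows "0 \<le> finite_mult f b d"
proof -
  have "sbelow f b \<subseteq> below f b" "below f b \<subseteq> sbelow f d" "sbelow f d \<subseteq> below f d" "below f d \<subseteq> \<Delta>"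
    using assms by (auto simp: below_def sbelow_def)
  from rank_exchange[OF this] show ?thesis
    by (simp add: finite_mult_def jump_def)
qed

section \<open>Coarsening of levels along a monotone map\<close>

lemma telescoping_jump:
  assumes "P \<subseteq> h ` \<Delta>" "\<And>u v. u \<in> P \<Longrightarrow> v \<in> h ` \<Delta> \<Longrightarrow> v \<le> u \<Longrightarrow> v \<in> P"
  shows "(\<Sum>u\<in>P. jump h G u) = G {x \<in> \<Delta>. h x \<in> P} - G {}"
proof -
  have "finite P" using finite_subset[OF assms(1)] finite_ground by simp
  then show ?thesis
    using assms
  proof (induction P rule: finite_linorder_max_induct)
    case empty
    then show ?case by simp
  next
    case (insert b A)
    have IH: "(\<Sum>u\<in>A. jump h G u) = G {x \<in> \<Delta>. h x \<in> A} - G {}"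
    proof (rule insert.IH)
      show "A \<subseteq> h ` \<Delta>" using insert.prems by blast
      show "v \<in> A" if "u \<in> A" "v \<in> h ` \<Delta>" "v \<le> u" for u v
        using insert.prems(2)[of u v] insert.hyps(2) that by force
    qed
    have b: "v \<in> insert b A" if "v \<in> h ` \<Delta>" "v \<le> b" for v
      using insert.prems(2)[of b v] that by simp
    \<comment> \<open>As \<open>b\<close> is the top of an initial segment of values, its strict
      sublevel set is exactly what the smaller values have collected, so the new jump continues the
      telescope.\<close>
    have "below h b = {x \<in> \<Delta>. h x \<in> insert b A}"
      using b insert.hyps(2) by (force simp: below_def)
    moreover have "sbelow h b = {x \<in> \<Delta>. h x \<in> A}"
      using b insert.hyps(2) by (force simp: sbelow_def)
    moreover have "b \<notin> A" using insert.hyps(2) by blast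
    ultimately show ?case
      using insert.hyps(1) by (simp add: IH jump_def[of h G b])
  qed
qed

text \<open>Monotonicity of \<open>\<phi>\<close> makes the values with
  \<open>\<phi> u \<le> b\<close> and with \<open>\<phi> u < b\<close> initial segments; subtracting
  their telescoped sums leaves the level \<open>\<phi> u = b\<close>.\<close>

lemma jump_coarsen:
  assumes f: "\<And>x. x \<in> \<Delta> \<Longrightarrow> f x = \<phi> (h x)" and mono: "mono_on (h ` \<Delta>) \<phi>"
  shows "jump f G b = (\<Sum>u\<in>{u \<in> h ` \<Delta>. \<phi> u = b}. jump h G u)"
proof -
  have le: "\<phi> v \<le> \<phi> u" if "u \<in> h ` \<Delta>" "v \<in> h ` \<Delta>" "v \<le> u" for u v
    using mono_onD[OF mono that(2,1,3)] .
  let ?le = "{u \<in> h ` \<Delta>. \<phi> u \<le> b}" and ?lt = "{u \<in> h ` \<Delta>. \<phi> u < b}"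
  have "(\<Sum>u\<in>?le. jump h G u) = G {x \<in> \<Delta>. h x \<in> ?le} - G {}"
    by (rule telescoping_jump) (use le order_trans in blast)+
  moreover have "{x \<in> \<Delta>. h x \<in> ?le} = below f b"
    using f by (auto simp: below_def)
  moreover have "(\<Sum>u\<in>?lt. jump h G u) = G {x \<in> \<Delta>. h x \<in> ?lt} - G {}"
    by (rule telescoping_jump) (use le le_less_trans in blast)+
  moreover have "{x \<in> \<Delta>. h x \<in> ?lt} = sbelow f b"
    using f by (auto simp: sbelow_def)
  moreover have "(\<Sum>u\<in>?le. jump h G u) = (\<Sum>u\<in>?lt. jump h G u) + (\<Sum>u\<in>{u \<in> h ` \<Delta>. \<phi> u = b}. jump h G u)"
    using finite_ground by (subst sum.union_disjoint[symmetric]) (auto intro!: sum.cong)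
  ultimately show ?thesis
    by (simp add: jump_def)
qed

lemma jump_sum: "jump h (\<lambda>A. \<Sum>i\<in>I. F i A) t = (\<Sum>i\<in>I. jump h (F i) t)"
  by (simp add: jump_def sum_subtractf)

definition push :: "(real \<Rightarrow> real) \<Rightarrow> real \<times> ereal \<Rightarrow> real \<times> ereal" where
  "push \<phi> = (\<lambda>(b, e). (\<phi> b, case e of ereal d \<Rightarrow> ereal (\<phi> d) | PInfty \<Rightarrow> \<infinity> | MInfty \<Rightarrow> -\<infinity>))"

lemma push_simps [simp]:
  "push \<phi> (b, ereal d) = (\<phi> b, ereal (\<phi> d))"
  "push \<phi> (b, \<infinity>) = (\<phi> b, \<infinity>)"
  by (simp_all add: push_def)

text \<open>Jumps vanish away from the values of \<open>h\<close>, so these finitely many candidates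
  contain every bar off the diagonal.\<close>

definition proper_pairs :: "('a \<Rightarrow> real) \<Rightarrow> (real \<times> ereal) set" where
  "proper_pairs h = {(u, ereal w) |u w. u \<in> h ` \<Delta> \<and> w \<in> h ` \<Delta> \<and> u < w} \<union> {(u, \<infinity>) |u. u \<in> h ` \<Delta>}"

lemma finite_proper_pairs: "finite (proper_pairs h)"
proof -
  have "proper_pairs h \<subseteq> h ` \<Delta> \<times> (ereal ` h ` \<Delta> \<union> {\<infinity>})"
    by (auto simp: proper_pairs_def)
  then show ?thesis
    by (rule finite_subset) (use finite_ground in auto)
qed

lemma point_mult_coarsen:
  assumes f: "\<And>x. x \<in> \<Delta> \<Longrightarrow> f x = \<phi> (h x)" and mono: "mono_on (h ` \<Delta>) \<phi>"
    and y: "snd y \<noteq> ereal (fst y)"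
  shows "point_mult f y = (\<Sum>x\<in>{x \<in> proper_pairs h. push \<phi> x = y}. point_mult h x)"
proof -
  obtain b e where ybe: "y = (b, e)" by fastforce
  note coarsen = jump_coarsen[where f = f and \<phi> = \<phi> and h = h, OF f mono]
  let ?lev = "\<lambda>b. {u \<in> h ` \<Delta>. \<phi> u = b}"
  have fin: "finite (?lev b)" for b using finite_ground by simp
  show ?thesis
  proof (cases e)
    case PInf
    have "{x \<in> proper_pairs h. push \<phi> x = y} = (\<lambda>u. (u, \<infinity>)) ` ?lev b"
      by (auto simp: proper_pairs_def ybe PInf)
    then have "(\<Sum>x\<in>{x \<in> proper_pairs h. push \<phi> x = y}. point_mult h x) =
        (\<Sum>u\<in>?lev b. nat (essential_mult h u))"
      by (simp add: sum.reindex inj_on_def)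
    also have "\<dots> = nat (\<Sum>u\<in>?lev b. essential_mult h u)"
      by (intro sum_nat_eq essential_mult_nonneg)
    also have "(\<Sum>u\<in>?lev b. essential_mult h u) = essential_mult f b"
      by (simp add: essential_mult_def coarsen)
    finally show ?thesis by (simp add: ybe PInf)
  next
    case MInf
    then have none: "{x \<in> proper_pairs h. push \<phi> x = y} = {}"
      by (auto simp: proper_pairs_def ybe)
    show ?thesis unfolding none by (simp add: ybe MInf)
  next
    case (real d)
    show ?thesis
    proof (cases "b < d")
      case True
      \<comment> \<open>Monotonicity puts the whole level of \<open>b\<close> below the level of
        \<open>d\<close>, so every pair from the two levels is proper.\<close>
      have less: "u < w" if "u \<in> ?lev b" "w \<in> ?lev d" for u w
        using mono_onD[OF mono, of w u] that True by (cases "u < w") auto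
      have "{x \<in> proper_pairs h. push \<phi> x = y} = (\<lambda>(u, w). (u, ereal w)) ` (?lev b \<times> ?lev d)"
      proof (intro equalityI subsetI)
        fix x assume "x \<in> {x \<in> proper_pairs h. push \<phi> x = y}"
        then obtain u w where "x = (u, ereal w)" "u \<in> ?lev b" "w \<in> ?lev d"
          by (auto simp: proper_pairs_def ybe real)
        then show "x \<in> (\<lambda>(u, w). (u, ereal w)) ` (?lev b \<times> ?lev d)"
          by (intro image_eqI[of _ _ "(u, w)"]) simp_all
      next
        fix x assume "x \<in> (\<lambda>(u, w). (u, ereal w)) ` (?lev b \<times> ?lev d)"
        then obtain u w where x: "x = (u, ereal w)" "u \<in> ?lev b" "w \<in> ?lev d"
          by (elim imageE SigmaE) simp
        then show "x \<in> {x \<in> proper_pairs h. push \<phi> x = y}"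
          using less[OF x(2,3)] by (simp add: proper_pairs_def ybe real)
      qed
      then have "(\<Sum>x\<in>{x \<in> proper_pairs h. push \<phi> x = y}. point_mult h x) =
          (\<Sum>z\<in>?lev b \<times> ?lev d. point_mult h (case z of (u, w) \<Rightarrow> (u, ereal w)))"
        by (simp add: sum.reindex inj_on_def)
      also have "\<dots> = (\<Sum>(u, w)\<in>?lev b \<times> ?lev d. nat (finite_mult h u w))"
        using less by (intro sum.cong) auto
      also have "\<dots> = nat (\<Sum>(u, w)\<in>?lev b \<times> ?lev d. finite_mult h u w)"
        unfolding case_prod_unfold using less finite_mult_nonneg by (intro sum_nat_eq) auto
      \<comment> \<open>The coarsening of jumps is applied in the birth and in the death variable;
        \<open>sum.swap\<close> aligns the order of summation.\<close>
      also have "(\<Sum>(u, w)\<in>?lev b \<times> ?lev d. finite_mult h u w) = finite_mult f b d"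
        by (simp add: finite_mult_def coarsen jump_sum sum.cartesian_product[symmetric] sum_negf)
          (rule sum.swap)
      finally show ?thesis using True by (simp add: ybe real)
    next
      case False
      \<comment> \<open>Off the diagonal this case means \<open>d < b\<close>, which a monotone map
        cannot produce from \<open>u < w\<close>.\<close>
      have none: "{x \<in> proper_pairs h. push \<phi> x = y} = {}"
        using False y mono_onD[OF mono] by (force simp: proper_pairs_def ybe real)
      show ?thesis unfolding none using False by (simp add: ybe real)
    qed
  qed
qed

section \<open>Bars and their images\<close>

definition bars :: "('a \<Rightarrow> real) \<Rightarrow> ((real \<times> ereal) \<times> nat) set" where
  "bars h = Sigma (proper_pairs h) (\<lambda>x. {..<point_mult h x})"

lemma finite_bars: "finite (bars h)"
  by (simp add: bars_def finite_proper_pairs)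

text \<open>Bars that \<open>\<phi>\<close> collapses are absorbed by the diagonal, so only fibres
  off the diagonal are counted.\<close>

lemma filtration_diagram_of_bars:
  assumes "\<And>x. x \<in> \<Delta> \<Longrightarrow> f x = \<phi> (h x)" "mono_on (h ` \<Delta>) \<phi>"
  shows "is_diagram_of (bars h) (\<lambda>q. push \<phi> (fst q)) (filtration_diagram f)"
proof -
  have "point_mult f y = card {q \<in> bars h. push \<phi> (fst q) = y}" if "snd y \<noteq> ereal (fst y)" for y
  proof -
    have "{q \<in> bars h. push \<phi> (fst q) = y} =
        Sigma {x \<in> proper_pairs h. push \<phi> x = y} (\<lambda>x. {..<point_mult h x})"
      by (auto simp: bars_def)
    then have "card {q \<in> bars h. push \<phi> (fst q) = y} =
        (\<Sum>x\<in>{x \<in> proper_pairs h. push \<phi> x = y}. point_mult h x)"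
      by (simp add: finite_proper_pairs)
    then show ?thesis
      using point_mult_coarsen[OF assms that] by simp
  qed
  then show ?thesis
    by (auto simp: is_diagram_of_def filtration_diagram_def fun_eq_iff)
qed

section \<open>Compatible orders and inversions\<close>

lemma monotone_factor:
  fixes f h :: "'a \<Rightarrow> real"
  assumes "\<And>x y. x \<in> \<Delta> \<Longrightarrow> y \<in> \<Delta> \<Longrightarrow> h x \<le> h y \<Longrightarrow> f x \<le> f y"
  obtains \<phi> where "\<And>x. x \<in> \<Delta> \<Longrightarrow> f x = \<phi> (h x)" "mono_on (h ` \<Delta>) \<phi>"
proof
  \<comment> \<open>The hypothesis makes \<open>f\<close> constant on the fibres of
    \<open>h\<close>, so any choice of preimage serves.\<close>
  let ?\<phi> = "\<lambda>u. f (inv_into \<Delta> h u)"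
  show eq: "f x = ?\<phi> (h x)" if "x \<in> \<Delta>" for x
    using that assms by (intro antisym) (auto simp: inv_into_into f_inv_into_f)
  show "mono_on (h ` \<Delta>) ?\<phi>"
  proof (rule mono_onI)
    fix u v assume "u \<in> h ` \<Delta>" "v \<in> h ` \<Delta>" "u \<le> v"
    then obtain x y where xy: "u = h x" "v = h y" "x \<in> \<Delta>" "y \<in> \<Delta>" "h x \<le> h y" by blast
    then have "f x \<le> f y" using assms by blast
    then show "?\<phi> u \<le> ?\<phi> v"
      using eq xy by metis
  qed
qed

text \<open>Strictness on both sides matters: a pair tied by either function is not inverted, so
  reaching a tie removes the pair.\<close>

definition inversions :: "('a \<Rightarrow> real) \<Rightarrow> ('a \<Rightarrow> real) \<Rightarrow> ('a \<times> 'a) set" where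
  "inversions f g = {(x, y). x \<in> \<Delta> \<and> y \<in> \<Delta> \<and> f x < f y \<and> g y < g x}"

lemma finite_inversions: "finite (inversions f g)"
  by (rule finite_subset[of _ "\<Delta> \<times> \<Delta>"]) (auto simp: inversions_def finite_ground)

text \<open>Without inversions both functions are monotone functions of \<open>f + g\<close>, so both diagrams are
  images of the bars of \<open>f + g\<close>.\<close>

lemma matched_no_inversions:
  assumes inv: "inversions f g = {}" and e: "0 \<le> e" "\<And>x. x \<in> \<Delta> \<Longrightarrow> \<bar>f x - g x\<bar> \<le> e"
  shows "matched (ereal e) (filtration_diagram f) (filtration_diagram g)"
proof -
  define h where "h x = f x + g x" for x
  have no: "f y \<le> f x \<or> g x \<le> g y" if "x \<in> \<Delta>" "y \<in> \<Delta>" for x y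
    using inv that by (force simp: inversions_def)
  \<comment> \<open>If \<open>f y < f x\<close>, then \<open>g y \<le> g x\<close> for lack of
    inversions, and adding the two contradicts \<open>h x \<le> h y\<close>.\<close>
  have fh: "f x \<le> f y" if "x \<in> \<Delta>" "y \<in> \<Delta>" "h x \<le> h y" for x y
    using no[of y x] that by (cases "f x \<le> f y") (auto simp: h_def)
  have gh: "g x \<le> g y" if "x \<in> \<Delta>" "y \<in> \<Delta>" "h x \<le> h y" for x y
    using no[of x y] that by (cases "g x \<le> g y") (auto simp: h_def)
  obtain \<phi> where \<phi>: "\<And>x. x \<in> \<Delta> \<Longrightarrow> f x = \<phi> (h x)" "mono_on (h ` \<Delta>) \<phi>"
    using monotone_factor[of h f] fh by blast
  obtain \<psi> where \<psi>: "\<And>x. x \<in> \<Delta> \<Longrightarrow> g x = \<psi> (h x)" "mono_on (h ` \<Delta>) \<psi>"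
    using monotone_factor[of h g] gh by blast
  show ?thesis
  proof (rule matched_common_index[OF finite_bars filtration_diagram_of_bars[OF \<phi>]
        filtration_diagram_of_bars[OF \<psi>]])
    show "0 \<le> ereal e" using e(1) by simp
    \<comment> \<open>Finite ends of bars are values of \<open>h\<close>, where
      \<open>\<phi>\<close> and \<open>\<psi>\<close> take the values of \<open>f\<close> and
      \<open>g\<close> at a common element.\<close>
    have close: "\<bar>\<phi> u - \<psi> u\<bar> \<le> e" if "u \<in> h ` \<Delta>" for u
      using that e(2) \<phi>(1) \<psi>(1) by auto
    fix q assume "q \<in> bars h"
    then have "fst q \<in> proper_pairs h" by (auto simp: bars_def)
    then show "linf_dist (push \<phi> (fst q)) (push \<psi> (fst q)) \<le> ereal e"
      using close e(1) by (auto simp: proper_pairs_def death_dist_def simp flip: zero_ereal_def)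
  qed
qed

text \<open>Both endpoints of the straight line from \<open>f\<close> to the first point \<open>m\<close> at which an inverted pair
  ties are compatible with one ordering, and \<open>m\<close> has fewer inversions with \<open>g\<close>.\<close>

theorem stability:
  assumes "\<And>x. x \<in> \<Delta> \<Longrightarrow> \<bar>f x - g x\<bar> \<le> e" "0 \<le> e"
  shows "matched (ereal e) (filtration_diagram f) (filtration_diagram g)"
  using assms
proof (induction "card (inversions f g)" arbitrary: f e rule: less_induct)
  case less
  show ?case
  proof (cases "inversions f g = {}")
    case True
    then show ?thesis using matched_no_inversions less.prems by blast
  next
    case False
    \<comment> \<open>The solution t of (1 - t) f x + t g x = (1 - t) f y + t g y. For an inversion
      both summands of the denominator are positive, so t lies strictly between 0 and 1.\<close>
    define L where "L = (\<lambda>(x, y). (f y - f x) / ((f y - f x) + (g x - g y)))"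
    define c where "c = Min (L ` inversions f g)"
    define m where "m x = (1 - c) * f x + c * g x" for x
    have fin: "finite (L ` inversions f g)" by (simp add: finite_inversions)
    have "c \<in> L ` inversions f g"
      unfolding c_def using fin False by (intro Min_in) auto
    then obtain x0 y0 where xy0: "(x0, y0) \<in> inversions f g" "c = L (x0, y0)" by auto
    then have c: "0 < c" "c < 1"
      by (auto simp: L_def inversions_def)
    have m_le: "m x \<le> m y" if "(x, y) \<in> inversions f g" for x y
    proof -
      have pos: "0 < (f y - f x) + (g x - g y)" using that by (auto simp: inversions_def)
      have "c \<le> L (x, y)" unfolding c_def using fin that by (intro Min_le) auto
      then have "c * ((f y - f x) + (g x - g y)) \<le> f y - f x"
        using pos by (simp add: L_def pos_le_divide_eq)
      then show ?thesis by (simp add: m_def algebra_simps)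
    qed
    have m_eq: "m x0 = m y0"
    proof -
      have "(f y0 - f x0) + (g x0 - g y0) \<noteq> 0" using xy0(1) by (auto simp: inversions_def)
      then have "c * ((f y0 - f x0) + (g x0 - g y0)) = f y0 - f x0"
        using xy0(2) by (simp add: L_def)
      then show ?thesis by (simp add: m_def algebra_simps)
    qed
    \<comment> \<open>Both weights are positive, so \<open>m\<close> keeps every strict order of one
      function that the other does not reverse.\<close>
    have m_less: "m x < m y" if "f x < f y" "g x \<le> g y" for x y
      unfolding m_def using that c by (intro add_less_le_mono mult_strict_left_mono mult_left_mono) auto
    have m_less': "m x < m y" if "f x \<le> f y" "g x < g y" for x y
      unfolding m_def using that c by (intro add_le_less_mono mult_strict_left_mono mult_left_mono) auto
    \<comment> \<open>For \<open>f x < f y\<close>, either \<open>g\<close> reverses the pair, which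
      at \<open>c\<close> has at most become a tie, or \<open>g\<close> does not, and
      \<open>m\<close> keeps the order strictly.\<close>
    have "inversions f m = {}"
    proof -
      have False if "x \<in> \<Delta>" "y \<in> \<Delta>" "f x < f y" "m y < m x" for x y
        using m_le[of x y] m_less[of x y] that by (cases "g x \<le> g y") (auto simp: inversions_def)
      then show ?thesis by (auto simp: inversions_def)
    qed
    moreover have "\<bar>f x - m x\<bar> \<le> c * e" if "x \<in> \<Delta>" for x
    proof -
      have "f x - m x = c * (f x - g x)" by (simp add: m_def algebra_simps)
      then show ?thesis using less.prems(1)[OF that] c by (simp add: abs_mult)
    qed
    ultimately have 1: "matched (ereal (c * e)) (filtration_diagram f) (filtration_diagram m)"
      using c less.prems(2) by (intro matched_no_inversions) auto
    have "inversions m g \<subseteq> inversions f g"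
    proof clarify
      fix x y assume xy: "(x, y) \<in> inversions m g"
      then have "\<not> f y \<le> f x" using m_less'[of y x] by (auto simp: inversions_def)
      then show "(x, y) \<in> inversions f g" using xy by (auto simp: inversions_def)
    qed
    \<comment> \<open>The pair attaining the minimum is tied by \<open>m\<close>, which makes the
      inclusion strict.\<close>
    moreover have "(x0, y0) \<notin> inversions m g" using m_eq by (simp add: inversions_def)
    ultimately have "card (inversions m g) < card (inversions f g)"
      using xy0(1) by (intro psubset_card_mono finite_inversions) blast
    moreover have "\<bar>m x - g x\<bar> \<le> (1 - c) * e" if "x \<in> \<Delta>" for x
    proof -
      have "m x - g x = (1 - c) * (f x - g x)" by (simp add: m_def algebra_simps)
      then show ?thesis using less.prems(1)[OF that] c by (simp add: abs_mult)
    qed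
    ultimately have "matched (ereal ((1 - c) * e)) (filtration_diagram m) (filtration_diagram g)"
      using c less.prems(2) by (intro less.hyps) auto
    from matched_trans[OF 1 this] show ?thesis
      by (simp add: algebra_simps)
  qed
qed

text \<open>The convention of \<^const>\<open>born_alive\<close> at step \<open>0\<close> agrees with \<open>jump\<close> because nothing lies
  strictly below the first parameter.\<close>

lemma filtration_diagram_eq_indexed:
  fixes t :: "nat \<Rightarrow> real" and m :: nat
  assumes t: "strict_mono t" and range: "\<And>x. x \<in> \<Delta> \<Longrightarrow> f x \<in> t ` {..m}"
    and A: "\<And>i j. born i j =
      int (r (below f (t i)) (below f (t j))) - (if i = 0 then 0 else int (r (below f (t (i - 1))) (below f (t j))))"
  shows "filtration_diagram f = (\<lambda>(b, d).
     if d = ereal b then \<infinity>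
     else if d = \<infinity> then enat (\<Sum>i\<in>{i. i \<le> m \<and> t i = b}. nat (born i m))
     else enat (\<Sum>(i, j)\<in>{(i, j). i < j \<and> j \<le> m \<and> t i = b \<and> ereal (t j) = d}.
            nat (born i (j - 1) - born i j)))"
proof -
  have t_eq: "t i = t j \<longleftrightarrow> i = j" for i j
    using strict_mono_eq[OF t] by blast
  have t_less: "t i < t j \<longleftrightarrow> i < j" and t_le: "t i \<le> t j \<longleftrightarrow> i \<le> j" for i j
    using strict_mono_less[OF t] strict_mono_less_eq[OF t] by auto
  \<comment> \<open>No value of \<open>f\<close> lies strictly between consecutive
    parameters.\<close>
  have sbelow_Suc: "sbelow f (t (Suc i)) = below f (t i)" for i
    using range by (fastforce simp: sbelow_def below_def t_less t_le less_Suc_eq_le)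
  have sbelow_0: "sbelow f (t 0) = {}"
    using range by (fastforce simp: sbelow_def t_less)
  \<comment> \<open>Everything has entered at the last parameter, so surviving to step
    \<open>m\<close> is the same as never dying.\<close>
  have top: "below f (t m) = \<Delta>"
    using range by (fastforce simp: below_def t_le)
  have jump_r: "jump f (\<lambda>A. int (r A (below f (t j)))) (t i) = born i j" for i j
    by (cases i) (auto simp: jump_def A sbelow_Suc sbelow_0 rank_empty below_def)
  have out: "below f b = sbelow f b" if "b \<notin> t ` {..m}" for b
    using range that by (force simp: below_def sbelow_def order_le_less)
  have jump_out: "jump f G b = 0" if "b \<notin> t ` {..m}" for G b
    by (simp add: jump_def out[OF that])
  have ess: "nat (essential_mult f b) = (\<Sum>i\<in>{i. i \<le> m \<and> t i = b}. nat (born i m))" for b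
  proof (cases "b \<in> t ` {..m}")
    case True
    then obtain i where i: "i \<le> m" "b = t i" by auto
    then have "{i. i \<le> m \<and> t i = b} = {i}" by (auto simp: t_eq)
    then show ?thesis using jump_r[of m i] i by (simp add: essential_mult_def top)
  next
    case False
    then have none: "{i. i \<le> m \<and> t i = b} = {}" by auto
    show ?thesis unfolding none by (simp add: essential_mult_def jump_out[OF False])
  qed
  have fin: "(if b < d then nat (finite_mult f b d) else 0) =
      (\<Sum>(i, j)\<in>{(i, j). i < j \<and> j \<le> m \<and> t i = b \<and> t j = d}. nat (born i (j - 1) - born i j))" for b d
  proof (cases "b \<in> t ` {..m} \<and> d \<in> t ` {..m} \<and> b < d")
    case True
    then obtain i j where ij: "i \<le> m" "j \<le> m" "b = t i" "d = t j" "i < j" by (auto simp: t_less)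
    then have "{(i, j). i < j \<and> j \<le> m \<and> t i = b \<and> t j = d} = {(i, j)}" by (auto simp: t_eq)
    \<comment> \<open>Since \<open>i < j\<close>, \<open>j - 1\<close> is a genuine predecessor, and
      what lies strictly below \<open>t j\<close> is the sublevel set of
      \<open>t (j - 1)\<close>.\<close>
    moreover obtain k where k: "j = Suc k" using ij(5) by (cases j) auto
    have "finite_mult f b d = born i k - born i j"
      unfolding finite_mult_def jump_r[symmetric] ij(3,4) k
      by (simp add: jump_def sbelow_Suc)
    ultimately show ?thesis using ij k by (simp add: t_less)
  next
    case False
    then have none: "{(i, j). i < j \<and> j \<le> m \<and> t i = b \<and> t j = d} = {}"
      by (auto simp: t_less)
    \<comment> \<open>If \<open>b\<close> is no parameter, the outer jump vanishes; if
      \<open>d\<close> is none, the inner one does.\<close>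
    have "finite_mult f b d = 0" if "b < d"
      using False that jump_out by (auto simp: finite_mult_def) (simp_all add: jump_def)
    then show ?thesis unfolding none by simp
  qed
  show ?thesis
  proof (rule ext, clarify)
    fix b e
    show "filtration_diagram f (b, e) =
       (if e = ereal b then \<infinity>
        else if e = \<infinity> then enat (\<Sum>i\<in>{i. i \<le> m \<and> t i = b}. nat (born i m))
        else enat (\<Sum>(i, j)\<in>{(i, j). i < j \<and> j \<le> m \<and> t i = b \<and> ereal (t j) = e}.
               nat (born i (j - 1) - born i j)))"
      by (cases e) (simp_all add: filtration_diagram_def ess fin)
  qed
qed

end

section \<open>The kNN filtration as a sublevel filtration\<close>

definition full_simplex :: "nat \<Rightarrow> nat set set" where
  "full_simplex N = {\<sigma>. \<sigma> \<noteq> {} \<and> \<sigma> \<subseteq> {1..N}}"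

lemma finite_full_simplex: "finite (full_simplex N)"
  by (rule finite_subset[of _ "Pow {1..N}"]) (auto simp: full_simplex_def)

lemma rank_function_homology_rank: "rank_function (full_simplex N) (homology_rank K n)"
proof
  show "finite (full_simplex N)" by (rule finite_full_simplex)
  show "homology_rank K n A C \<le> homology_rank K n B C"
    if "A \<subseteq> B" "B \<subseteq> C" "C \<subseteq> full_simplex N" for A B C
    using homology_rank_mono[OF finite_subset[OF that(3) finite_full_simplex] that(1,2)] .
  show "homology_rank K n B D + homology_rank K n A C \<le> homology_rank K n A D + homology_rank K n B C"
    if "A \<subseteq> B" "B \<subseteq> C" "C \<subseteq> D" "D \<subseteq> full_simplex N" for A B C D
    using homology_rank_exchange[OF finite_subset[OF that(4) finite_full_simplex] that(1-3)] .
  show "homology_rank K n {} A = 0" if "A \<subseteq> full_simplex N" for A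
    by (rule homology_rank_empty[OF finite_subset[OF that finite_full_simplex]])
qed

section \<open>Entry values of simplices\<close>

definition edge_value :: "symmetrization \<Rightarrow> nat \<Rightarrow> nat \<Rightarrow> cloud \<Rightarrow> nat \<Rightarrow> nat \<Rightarrow> real" where
  "edge_value s N p Y i j = symmetrize s (knn_order N p Y i j) (knn_order N p Y j i)"

text \<open>A clique appears together with its last edge. The inserted 0 covers single vertices,
  which have no edges and enter at the first parameter.\<close>

definition entry_value :: "symmetrization \<Rightarrow> nat \<Rightarrow> nat \<Rightarrow> cloud \<Rightarrow> nat set \<Rightarrow> real" where
  "entry_value s N p Y \<sigma> =
     Max (insert 0 ((\<lambda>(i, j). edge_value s N p Y i j) ` {(i, j) \<in> \<sigma> \<times> \<sigma>. i \<noteq> j}))"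

lemma finite_edges: "finite \<sigma> \<Longrightarrow> finite {(i, j) \<in> \<sigma> \<times> \<sigma>. i \<noteq> j}"
  by (rule finite_subset[of _ "\<sigma> \<times> \<sigma>"]) auto

lemma entry_value_le_iff:
  assumes "finite \<sigma>"
  shows "entry_value s N p Y \<sigma> \<le> t \<longleftrightarrow>
    0 \<le> t \<and> (\<forall>i\<in>\<sigma>. \<forall>j\<in>\<sigma>. i \<noteq> j \<longrightarrow> edge_value s N p Y i j \<le> t)"
  using finite_edges[OF assms] by (auto simp: entry_value_def)

text \<open>The index \<open>j\<close> is never counted against itself.\<close>

lemma knn_order_le:
  assumes "j \<in> {1..N}"
  shows "knn_order N p Y i j \<le> N - 1"
proof -
  have "knn_order N p Y i j \<le> card ({1..N} - {j})"
    unfolding knn_order_def by (intro card_mono) auto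
  then show ?thesis using assms by simp
qed

lemma knn_order_diff_le:
  assumes "i \<in> {1..N}" "j \<in> {1..N}"
  shows "\<bar>real (knn_order N p Y i j) - real (knn_order N p Y' i j)\<bar> \<le> knn_matrix_dist N p Y Y'"
  unfolding knn_matrix_dist_def using assms by (intro Max_ge) (auto intro!: image_eqI[of _ _ "(i, j)"])

text \<open>Minimum, average and maximum are all 1-Lipschitz for the maximum norm.\<close>

lemma symmetrize_close:
  assumes "\<bar>real a - real a'\<bar> \<le> e" "\<bar>real b - real b'\<bar> \<le> e"
  shows "\<bar>symmetrize s a b - symmetrize s a' b'\<bar> \<le> e"
proof (cases s)
  case SymAvg
  have split: "(real a + real b) / 2 - (real a' + real b') / 2 =
      ((real a - real a') + (real b - real b')) / 2"
    by (simp add: field_simps)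
  have "\<bar>(real a + real b) / 2 - (real a' + real b') / 2\<bar> =
      \<bar>(real a - real a') + (real b - real b')\<bar> / 2"
    unfolding split by simp
  also have "\<dots> \<le> (\<bar>real a - real a'\<bar> + \<bar>real b - real b'\<bar>) / 2"
    by (intro divide_right_mono abs_triangle_ineq) simp
  also have "\<dots> \<le> (e + e) / 2"
    by (intro divide_right_mono add_mono assms) simp
  finally show ?thesis using SymAvg by simp
qed (use assms in \<open>auto simp: of_nat_min of_nat_max min_def max_def\<close>)

lemma entry_value_le_shift:
  assumes "\<sigma> \<in> full_simplex N"
  shows "entry_value s N p Y \<sigma> \<le> entry_value s N p Y' \<sigma> + knn_matrix_dist N p Y Y'"
proof -
  have fin: "finite \<sigma>" and sub: "\<sigma> \<subseteq> {1..N}" and ne: "\<sigma> \<noteq> {}"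
    using assms finite_subset[of \<sigma> "{1..N}"] by (auto simp: full_simplex_def)
  have close: "\<bar>edge_value s N p Y i j - edge_value s N p Y' i j\<bar> \<le> knn_matrix_dist N p Y Y'"
    if "i \<in> \<sigma>" "j \<in> \<sigma>" for i j
    unfolding edge_value_def using that sub by (intro symmetrize_close knn_order_diff_le) auto
  have le: "0 \<le> entry_value s N p Y' \<sigma>"
    "\<And>i j. i \<in> \<sigma> \<Longrightarrow> j \<in> \<sigma> \<Longrightarrow> i \<noteq> j \<Longrightarrow> edge_value s N p Y' i j \<le> entry_value s N p Y' \<sigma>"
    using entry_value_le_iff[OF fin, of s N p Y' "entry_value s N p Y' \<sigma>"] by auto
  \<comment> \<open>A vertex of the nonempty simplex witnesses that the matrix distance is
    nonnegative, as the inserted 0 demands.\<close>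
  obtain i0 where "i0 \<in> \<sigma>" using ne by blast
  then have "0 \<le> knn_matrix_dist N p Y Y'"
    using close[of i0 i0] by linarith
  then show ?thesis
    unfolding entry_value_le_iff[OF fin] using le close by force
qed

lemma param_range_symmetrize:
  assumes "a \<le> N - 1" "b \<le> N - 1"
  shows "symmetrize s a b \<in> param s ` {..last_index s N}"
proof (cases s)
  case SymMin
  then show ?thesis using assms by (auto intro!: image_eqI[of _ _ "min a b"])
next
  case SymAvg
  \<comment> \<open>Half-integers are indexed by their doubles, and \<open>a + b\<close> is at most
    2 (N - 1).\<close>
  then show ?thesis using assms by (auto intro!: image_eqI[of _ _ "a + b"])
next
  case SymMax
  then show ?thesis using assms by (auto intro!: image_eqI[of _ _ "max a b"])
qed

lemma param_0: "param s 0 = 0"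
  by (cases s) auto

lemma strict_mono_param: "strict_mono (param s)"
  by (cases s) (auto simp: strict_mono_def)

lemma entry_value_in_param:
  assumes "\<sigma> \<in> full_simplex N"
  shows "entry_value s N p Y \<sigma> \<in> param s ` {..last_index s N}"
proof -
  let ?E = "insert 0 ((\<lambda>(i, j). edge_value s N p Y i j) ` {(i, j) \<in> \<sigma> \<times> \<sigma>. i \<noteq> j})"
  have fin: "finite \<sigma>" and sub: "\<sigma> \<subseteq> {1..N}"
    using assms finite_subset[of \<sigma> "{1..N}"] by (auto simp: full_simplex_def)
  have "entry_value s N p Y \<sigma> \<in> ?E"
    unfolding entry_value_def using finite_edges[OF fin] by (intro Max_in) auto
  moreover have "?E \<subseteq> param s ` {..last_index s N}"
  proof -
    have "edge_value s N p Y i j \<in> param s ` {..last_index s N}" if "i \<in> \<sigma>" "j \<in> \<sigma>" for i j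
      unfolding edge_value_def using that sub by (intro param_range_symmetrize knn_order_le) auto
    moreover have "0 \<in> param s ` {..last_index s N}"
      by (rule image_eqI[of _ _ 0]) (auto simp: param_0)
    ultimately show ?thesis by auto
  qed
  ultimately show ?thesis by blast
qed

lemma knn_complex_eq_sublevel:
  assumes "0 \<le> t"
  shows "knn_complex s N p Y t = {\<sigma> \<in> full_simplex N. entry_value s N p Y \<sigma> \<le> t}"
  using assms finite_subset[of _ "{1..N}"]
  by (auto simp: knn_complex_def clique_complex_def knn_graph_adj_def full_simplex_def
      entry_value_le_iff edge_value_def)

lemma knn_diagram_eq_filtration_diagram:
  "knn_diagram K n s N p Y =
     rank_function.filtration_diagram (full_simplex N) (homology_rank K n) (entry_value s N p Y)"
proof -
  interpret rank_function "full_simplex N" "homology_rank K n"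
    by (rule rank_function_homology_rank)
  have "0 \<le> param s i" for i by (cases s) auto
  then have X: "knn_complex s N p Y (param s i) = below (entry_value s N p Y) (param s i)" for i
    by (simp add: knn_complex_eq_sublevel below_def)
  show ?thesis
    unfolding knn_diagram_def persistence_diagram_def pair_mult_def X
    by (rule filtration_diagram_eq_indexed[symmetric, OF strict_mono_param entry_value_in_param])
      (simp_all add: born_alive_def)
qed

theorem knn_bottleneck_stability:
  assumes "1 \<le> N"
  shows "bottleneck_dist (knn_diagram K n s N p Y) (knn_diagram K n s N p Y')
    \<le> ereal (knn_matrix_dist N p Y Y')"
proof -
  interpret rank_function "full_simplex N" "homology_rank K n"
    by (rule rank_function_homology_rank)
  have sym: "knn_matrix_dist N p Y' Y = knn_matrix_dist N p Y Y'"
    by (simp add: knn_matrix_dist_def abs_minus_commute)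
  have "0 \<le> knn_matrix_dist N p Y Y'"
    using knn_order_diff_le[of 1 N 1 p Y Y'] assms by simp
  moreover have "\<bar>entry_value s N p Y \<sigma> - entry_value s N p Y' \<sigma>\<bar> \<le> knn_matrix_dist N p Y Y'"
    if "\<sigma> \<in> full_simplex N" for \<sigma>
    using entry_value_le_shift[OF that, of s p Y Y'] entry_value_le_shift[OF that, of s p Y' Y]
    by (simp add: sym abs_le_iff)
  ultimately show ?thesis
    unfolding knn_diagram_eq_filtration_diagram
    by (intro bottleneck_dist_le_matched stability) auto
qed

section \<open>Failure of a Lipschitz bound in the point locations\<close>

definition line_cloud :: "real \<Rightarrow> cloud" where
  "line_cloud x i c = (if i = 1 then 0 else if i = 2 then 1 else - x)"

lemma euclid_dist_1: "euclid_dist (Suc 0) x y = \<bar>x 0 - y 0\<bar>"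
  by (simp add: euclid_dist_def L2_set_def lessThan_Suc)

lemma atLeastAtMost_1_3: "{Suc 0..3} = {1, 2, 3}"
  by auto

text \<open>From the first point the distances are 0, 1, x, where \<open>x \<noteq> 1\<close>
  excludes a tie; from the others they are 0, 1, 1 + x and 0, x, 1 + x, distinct as
  \<open>0 < x\<close>.\<close>

lemma well_ordered_line_cloud:
  assumes "0 < x" "x \<noteq> 1"
  shows "well_ordered_cloud 3 1 (line_cloud x)"
  using assms
  by (simp add: well_ordered_cloud_def atLeastAtMost_1_3 euclid_dist_1 line_cloud_def inj_on_def)

lemma knn_order_line_cloud:
  assumes "0 < x"
  shows "knn_order 3 1 (line_cloud x) 1 2 = (if x < 1 then 2 else 1)"
proof -
  have "{l \<in> {1..3}. euclid_dist 1 (line_cloud x 1) (line_cloud x l)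
      < euclid_dist 1 (line_cloud x 1) (line_cloud x 2)} = (if x < 1 then {1, 3} else {1})"
    using assms
    by (simp add: atLeastAtMost_1_3 euclid_dist_1 line_cloud_def set_eq_iff del: atLeastAtMost_iff)
  then show ?thesis by (simp add: knn_order_def)
qed

lemma cloud_dist_line_cloud: "cloud_dist 3 1 (line_cloud x) (line_cloud y) = \<bar>x - y\<bar>"
  by (simp add: cloud_dist_def atLeastAtMost_1_3 euclid_dist_1 line_cloud_def)

text \<open>The two nearest neighbours of the first point swap when \<open>x\<close> crosses \<open>1\<close>, however small the move.\<close>

lemma knn_matrix_dist_not_lipschitz:
  fixes L :: real
  obtains Y Y' where "well_ordered_cloud 3 1 Y" "well_ordered_cloud 3 1 Y'"
    "L * cloud_dist 3 1 Y Y' < knn_matrix_dist 3 1 Y Y'"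
proof
  \<comment> \<open>Chosen so that the displacement 2 d times the absolute value of \<open>L\<close>
    stays below 1, the least possible change of a rank.\<close>
  define d where "d = 1 / (2 * \<bar>L\<bar> + 2)"
  have d: "0 < d" "d < 1" by (auto simp: d_def field_simps)
  show "well_ordered_cloud 3 1 (line_cloud (1 - d))" "well_ordered_cloud 3 1 (line_cloud (1 + d))"
    using d by (intro well_ordered_line_cloud; simp)+
  have "L * cloud_dist 3 1 (line_cloud (1 - d)) (line_cloud (1 + d)) = 2 * d * L"
    using d by (simp only: cloud_dist_line_cloud) simp
  also have "\<dots> \<le> 2 * d * \<bar>L\<bar>" using d by (intro mult_left_mono) auto
  also have "\<dots> < 1" by (simp add: d_def field_simps)
  \<comment> \<open>The entry at (1, 2) is 2 for \<open>1 - d\<close> and 1 for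
    \<open>1 + d\<close>.\<close>
  also have "1 \<le> knn_matrix_dist 3 1 (line_cloud (1 - d)) (line_cloud (1 + d))"
    using knn_order_diff_le[of 1 3 2 1 "line_cloud (1 - d)" "line_cloud (1 + d)"] d
      knn_order_line_cloud[of "1 - d"] knn_order_line_cloud[of "1 + d"] by simp
  finally show "L * cloud_dist 3 1 (line_cloud (1 - d)) (line_cloud (1 + d))
    < knn_matrix_dist 3 1 (line_cloud (1 - d)) (line_cloud (1 + d))" .
qed

theorem theorem3p11:
  fixes K :: "'f::field itself" and n :: nat and s :: symmetrization
  shows "(\<forall>N p Y Y'. N \<ge> 2 \<and> p \<ge> 1 \<and> well_ordered_cloud N p Y \<and> well_ordered_cloud N p Y' \<longrightarrow>
            bottleneck_dist (knn_diagram K n s N p Y) (knn_diagram K n s N p Y')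
              \<le> ereal (knn_matrix_dist N p Y Y')) \<and>
         \<not> (\<exists>L::real. \<forall>N p Y Y'.
              N \<ge> 2 \<and> p \<ge> 1 \<and> well_ordered_cloud N p Y \<and> well_ordered_cloud N p Y' \<longrightarrow>
              bottleneck_dist (knn_diagram K n s N p Y) (knn_diagram K n s N p Y')
                \<le> ereal (knn_matrix_dist N p Y Y') \<and>
              ereal (knn_matrix_dist N p Y Y') \<le> ereal (L * cloud_dist N p Y Y'))"
proof (intro conjI)
  show "\<not> (\<exists>L::real. \<forall>N p Y Y'.
      N \<ge> 2 \<and> p \<ge> 1 \<and> well_ordered_cloud N p Y \<and> well_ordered_cloud N p Y' \<longrightarrow>
      bottleneck_dist (knn_diagram K n s N p Y) (knn_diagram K n s N p Y')
        \<le> ereal (knn_matrix_dist N p Y Y') \<and>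
      ereal (knn_matrix_dist N p Y Y') \<le> ereal (L * cloud_dist N p Y Y'))"
  proof
    assume "\<exists>L::real. \<forall>N p Y Y'.
      N \<ge> 2 \<and> p \<ge> 1 \<and> well_ordered_cloud N p Y \<and> well_ordered_cloud N p Y' \<longrightarrow>
      bottleneck_dist (knn_diagram K n s N p Y) (knn_diagram K n s N p Y')
        \<le> ereal (knn_matrix_dist N p Y Y') \<and>
      ereal (knn_matrix_dist N p Y Y') \<le> ereal (L * cloud_dist N p Y Y')"
    then obtain L :: real where L: "\<And>N p Y Y'. N \<ge> 2 \<and> p \<ge> 1 \<and> well_ordered_cloud N p Y \<and>
        well_ordered_cloud N p Y' \<longrightarrow> ereal (knn_matrix_dist N p Y Y') \<le> ereal (L * cloud_dist N p Y Y')"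
      by blast
    obtain Y Y' where "well_ordered_cloud 3 1 Y" "well_ordered_cloud 3 1 Y'"
      "L * cloud_dist 3 1 Y Y' < knn_matrix_dist 3 1 Y Y'"
      by (rule knn_matrix_dist_not_lipschitz)
    with L[of 3 1 Y Y'] show False by simp
  qed
qed (simp add: knn_bottleneck_stability)

end
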